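(* Let $\ell\ge 1$ and $n\ge 2\ell+1$ be integers with $(n,\ell)\ne(5,2)$. Then the $(n-\ell)$-deck of an $n$-vertex graph determines whether the graph contains a cycle. That is, if $G$ and $G'$ are two $n$-vertex graphs having the same $(n-\ell)$-deck, then $G$ contains a cycle if and only if $G'$ contains a cycle.
   Context: All graphs are finite and simple. The $k$-deck of a graph is the multiset of (isomorphism classes of) its $k$-vertex induced subgraphs, one for each $k$-element subset of the vertex set. Thus the $(n-\ell)$-deck of an $n$-vertex graph is the multiset of induced subgraphs obtained by deleting $\ell$ vertices. *)

theory Defs
  imports "Graph_Theory.Graph_Theory" "HOL-Library.Multiset"
begin

text \<open>
  Finite simple graphs are digraphs satisfying the locale \<^locale>\<open>graph\<close>: finite, loop-free,
  without parallel arcs, and symmetric. An undirected edge is thus a pair of opposite arcs.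

  Isomorphism classes are cut down to graphs on natural numbers, so that the classes of graphs
  over different types can be compared. No information is lost for finite graphs, see
  \<open>iso_class_eq_iff\<close> below.
\<close>

definition iso_class :: "('a, 'b) pre_digraph \<Rightarrow> (nat, nat) pre_digraph set" where
  "iso_class G = {H. digraph_iso G H}"

definition deck :: "nat \<Rightarrow> ('a, 'b) pre_digraph \<Rightarrow> (nat, nat) pre_digraph set multiset" where
  "deck k G = image_mset (\<lambda>S. iso_class (G \<restriction> S)) (mset_set {S. S \<subseteq> verts G \<and> card S = k})"

text \<open>
  In a symmetric digraph, an arc followed by its reverse satisfies \<^const>\<open>pre_digraph.cycle\<close>.
  The length bound excludes exactly these.
\<close>

definition has_cycle :: "('a, 'b) pre_digraph \<Rightarrow> bool" where
  "has_cycle G \<longleftrightarrow> (\<exists>p. pre_digraph.cycle G p \<and> length p \<ge> 3)"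

lemma digraph_iso_sym:
  assumes "digraph_iso G H"
  shows "digraph_iso H G"
proof -
  obtain f where f: "pre_digraph.digraph_isomorphism G f" "H = app_iso f G"
    using assms by (auto simp: digraph_iso_def)
  have "pre_digraph.digraph_isomorphism H (pre_digraph.inv_iso G f)"
    using f(1) wf_digraph.digraph_isomorphism_invI[of G f]
    by (simp add: f(2) pre_digraph.digraph_isomorphism_def)
  moreover have "G = app_iso (pre_digraph.inv_iso G f) H"
    using pre_digraph.app_iso_inv[OF f(1)] by (simp add: f(2))
  ultimately show ?thesis by (auto simp: digraph_iso_def)
qed

lemma digraph_iso_trans:
  assumes "digraph_iso G H" "digraph_iso H K"
  shows "digraph_iso G K"
proof -
  obtain f where f: "pre_digraph.digraph_isomorphism G f" "H = app_iso f G"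
    using assms by (auto simp: digraph_iso_def)
  obtain g where g: "pre_digraph.digraph_isomorphism H g" "K = app_iso g H"
    using assms by (auto simp: digraph_iso_def)
  define h where "h = \<lparr>iso_verts = iso_verts g \<circ> iso_verts f, iso_arcs = iso_arcs g \<circ> iso_arcs f,
    iso_head = iso_head g, iso_tail = iso_tail g\<rparr>"
  have "pre_digraph.digraph_isomorphism G h"
    using f(1) g(1) unfolding f(2) pre_digraph.digraph_isomorphism_def h_def
    by (auto intro!: comp_inj_on)
  moreover have "K = app_iso h G"
    by (simp add: f(2) g(2) h_def app_iso_def image_comp)
  ultimately show ?thesis by (auto simp: digraph_iso_def)
qed

lemma iso_class_nonempty:
  assumes "fin_digraph G"
  shows "iso_class G \<noteq> {}"
proof -
  interpret fin_digraph G by fact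
  obtain fv :: "'a \<Rightarrow> nat" where fv: "inj_on fv (verts G)"
    using finite_imp_inj_to_nat_seg[OF finite_verts] by auto
  obtain fa :: "'b \<Rightarrow> nat" where fa: "inj_on fa (arcs G)"
    using finite_imp_inj_to_nat_seg[OF finite_arcs] by auto
  define h where "h = \<lparr>iso_verts = fv, iso_arcs = fa,
    iso_head = fv \<circ> head G \<circ> the_inv_into (arcs G) fa,
    iso_tail = fv \<circ> tail G \<circ> the_inv_into (arcs G) fa\<rparr>"
  have "digraph_isomorphism h"
    using fv fa wf_digraph by (auto simp: digraph_isomorphism_def h_def the_inv_into_f_f)
  then show ?thesis by (auto simp: iso_class_def digraph_iso_def)
qed

lemma iso_class_eq_iff:
  assumes "fin_digraph G"
  shows "iso_class G = iso_class H \<longleftrightarrow> digraph_iso G H"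
proof
  assume "iso_class G = iso_class H"
  with iso_class_nonempty[OF assms] obtain K :: "(nat, nat) pre_digraph"
    where "digraph_iso G K" "digraph_iso H K"
    by (auto simp: iso_class_def)
  then show "digraph_iso G H" by (blast intro: digraph_iso_sym digraph_iso_trans)
next
  assume "digraph_iso G H"
  then show "iso_class G = iso_class H"
    by (auto simp: iso_class_def intro: digraph_iso_sym digraph_iso_trans)
qed

end

theory Submission
  imports Defs
begin

text \<open>
  Let \<open>k = n - l\<close>, so \<open>n < 2k\<close>; let \<open>F\<close> be acyclic and let \<open>H\<close> contain a cycle, with the same
  \<open>k\<close>-deck. A shortest cycle \<open>C\<close> of \<open>H\<close> has more than \<open>k\<close> vertices. For an induced subgraph \<open>T\<close> of \<open>H\<close>,
  the deck determines \<open>\<Sum>\<^sub>S (d\<^sub>S choose i)\<close> whenever \<open>card T + i \<le> k\<close>, where \<open>S\<close> runs over the induced copies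
  of \<open>T\<close> and \<open>d\<^sub>S\<close> is the number of vertices outside \<open>S\<close> with a neighbour in \<open>S\<close>. If \<open>T\<close> is a component
  of \<open>H\<close> disjoint from \<open>C\<close>, then every copy in \<open>H\<close> satisfies \<open>d\<^sub>S \<le> k - card T\<close>, since \<open>S\<close> together with
  its neighbours meets \<open>C\<close> in at most \<open>card T + 2\<close> vertices. If the copies in \<open>F\<close> satisfy the same bound,
  then inverting the binomial sums shows that \<open>F\<close> and \<open>H\<close> have equally many components isomorphic to \<open>T\<close>.
  Deleting all these components leaves as many vertices and edges in \<open>F\<close> as in \<open>H\<close>; but what is left of
  \<open>H\<close> is the component of \<open>C\<close>, which has at least as many edges as vertices, so \<open>F\<close> has a cycle.

  A copy in \<open>F\<close> with \<open>d\<^sub>S > k - card T\<close> forces equality in the bound for some copy in \<open>H\<close>. Then \<open>H\<close>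
  consists of \<open>T\<close>, \<open>C\<close> and \<open>k - 2 - card T\<close> further vertices attached to one path of \<open>C\<close>. For
  \<open>card T \<ge> 2\<close> the deck determines the number of leaves, which is too small in \<open>H\<close>; for
  \<open>card T = 1\<close> there are too few vertices of degree \<open>k - 1\<close> in \<open>H\<close>, unless \<open>(n, k) = (5, 3)\<close>.
\<close>

section \<open>Edge counts and connected sets\<close>

text \<open>Ordered pairs are counted, so \<open>adj_card E W W\<close> is twice the number of edges inside \<open>W\<close>: a
  graph is acyclic iff \<open>adj_card E W W < 2 * card W\<close> for all nonempty \<open>W\<close>.\<close>

definition adj_card :: "('a \<Rightarrow> 'a \<Rightarrow> bool) \<Rightarrow> 'a set \<Rightarrow> 'a set \<Rightarrow> nat" where
  "adj_card E A B = card {(a, b). a \<in> A \<and> b \<in> B \<and> E a b}"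

text \<open>\<open>nbhd E V S = {}\<close> says that \<open>S\<close>, a subset of \<open>V\<close>,
  is a union of components; with \<open>connected_in E S\<close> added, a single component.\<close>

definition nbhd :: "('a \<Rightarrow> 'a \<Rightarrow> bool) \<Rightarrow> 'a set \<Rightarrow> 'a set \<Rightarrow> 'a set" where
  "nbhd E V S = {v \<in> V - S. \<exists>s\<in>S. E s v}"

text \<open>Phrased by cuts instead of paths: a failure directly splits the set into two parts
  without edges between them.\<close>

definition connected_in :: "('a \<Rightarrow> 'a \<Rightarrow> bool) \<Rightarrow> 'a set \<Rightarrow> bool" where
  "connected_in E S \<longleftrightarrow> S \<noteq> {} \<and> (\<forall>A\<subseteq>S. A \<noteq> {} \<longrightarrow> A \<noteq> S \<longrightarrow> (\<exists>a\<in>A. \<exists>b\<in>S - A. E a b))"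

lemma adj_card_pairs_finite:
  "finite A \<Longrightarrow> finite B \<Longrightarrow> finite {(a, b). a \<in> A \<and> b \<in> B \<and> E a b}"
  by (rule finite_subset[of _ "A \<times> B"]) auto

lemma adj_card_Un_left:
  assumes "finite A" "finite B" "finite X" "A \<inter> B = {}"
  shows "adj_card E (A \<union> B) X = adj_card E A X + adj_card E B X"
proof -
  have "{(a, b). a \<in> A \<union> B \<and> b \<in> X \<and> E a b} =
      {(a, b). a \<in> A \<and> b \<in> X \<and> E a b} \<union> {(a, b). a \<in> B \<and> b \<in> X \<and> E a b}"
    by auto
  moreover have "{(a, b). a \<in> A \<and> b \<in> X \<and> E a b} \<inter> {(a, b). a \<in> B \<and> b \<in> X \<and> E a b} = {}"
    using assms(4) by auto
  ultimately show ?thesis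
    unfolding adj_card_def
    by (simp add: card_Un_disjoint adj_card_pairs_finite assms)
qed

lemma adj_card_mono:
  assumes "finite A'" "finite B'" "A \<subseteq> A'" "B \<subseteq> B'"
  shows "adj_card E A B \<le> adj_card E A' B'"
  unfolding adj_card_def
  by (rule card_mono[OF adj_card_pairs_finite]) (use assms in auto)

lemma adj_card_empty [simp]: "adj_card E {} B = 0" "adj_card E A {} = 0"
  by (simp_all add: adj_card_def)

lemma adj_card_singleton: "adj_card E {v} B = card {b \<in> B. E v b}"
proof -
  have "{(a, b). a \<in> {v} \<and> b \<in> B \<and> E a b} = Pair v ` {b \<in> B. E v b}" by auto
  then show ?thesis by (simp add: adj_card_def card_image inj_on_def)
qed

lemma adj_card_sum:
  assumes "finite A" "finite B"
  shows "adj_card E A B = (\<Sum>v\<in>A. adj_card E {v} B)"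
  using assms(1)
proof (induction A rule: finite_induct)
  case (insert x F)
  then show ?case using adj_card_Un_left[of "{x}" F B E] assms(2) by simp
qed simp

lemma adj_card_ge_1:
  assumes "finite A" "finite B" "a \<in> A" "b \<in> B" "E a b"
  shows "adj_card E A B \<ge> 1"
proof -
  have "{(a, b)} \<subseteq> {(a, b). a \<in> A \<and> b \<in> B \<and> E a b}" using assms by auto
  from card_mono[OF adj_card_pairs_finite[OF assms(1,2)] this] show ?thesis
    by (simp add: adj_card_def)
qed

lemma adj_card_eq_0_iff:
  assumes "finite A" "finite B"
  shows "adj_card E A B = 0 \<longleftrightarrow> (\<forall>a\<in>A. \<forall>b\<in>B. \<not> E a b)"
  using adj_card_pairs_finite[OF assms, of E] by (auto simp: adj_card_def)

lemma finite_nbhd [simp]: "finite V \<Longrightarrow> finite (nbhd E V S)"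
  by (simp add: nbhd_def)

lemma nbhd_eq_empty_iff: "nbhd E V S = {} \<longleftrightarrow> (\<forall>s\<in>S. \<forall>v\<in>V - S. \<not> E s v)"
  by (auto simp: nbhd_def)

lemma card_nbhd_Int_le:
  assumes "finite S" "finite B" "\<And>b. b \<in> B \<Longrightarrow> b \<notin> S"
  shows "card (nbhd E V S \<inter> B) \<le> adj_card E S B"
proof -
  have "nbhd E V S \<inter> B \<subseteq> snd ` {(a, b). a \<in> S \<and> b \<in> B \<and> E a b}"
    by (force simp: nbhd_def)
  then have "card (nbhd E V S \<inter> B) \<le> card (snd ` {(a, b). a \<in> S \<and> b \<in> B \<and> E a b})"
    by (rule card_mono[rotated]) (intro finite_imageI adj_card_pairs_finite assms)
  also have "\<dots> \<le> adj_card E S B"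
    unfolding adj_card_def by (intro card_image_le adj_card_pairs_finite assms)
  finally show ?thesis .
qed

lemma connected_in_singleton [simp]: "connected_in E {v}"
  by (auto simp: connected_in_def)

locale simple_adj =
  fixes E :: "'a \<Rightarrow> 'a \<Rightarrow> bool"
  assumes adj_sym: "E u v \<Longrightarrow> E v u"
    and adj_irrefl: "\<not> E v v"
begin

lemma adj_card_commute: "adj_card E A B = adj_card E B A"
proof -
  have "{(a, b). a \<in> B \<and> b \<in> A \<and> E a b} = prod.swap ` {(a, b). a \<in> A \<and> b \<in> B \<and> E a b}"
    by (auto intro: adj_sym)
  then show ?thesis by (simp add: adj_card_def card_image)
qed

lemma adj_card_Un_right:
  assumes "finite A" "finite B" "finite X" "A \<inter> B = {}"
  shows "adj_card E X (A \<union> B) = adj_card E X A + adj_card E X B"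
  using adj_card_Un_left[OF assms, of E] by (simp add: adj_card_commute[of X])

lemma adj_card_Un_Un:
  assumes "finite A" "finite B" "A \<inter> B = {}"
  shows "adj_card E (A \<union> B) (A \<union> B) = adj_card E A A + adj_card E B B + 2 * adj_card E A B"
  using assms adj_card_commute[of B A]
  by (simp add: adj_card_Un_left adj_card_Un_right)

lemma adj_card_self_singleton [simp]: "adj_card E {v} {v} = 0"
  by (simp add: adj_card_singleton adj_irrefl)

lemma adj_card_insert:
  assumes "finite A" "v \<notin> A"
  shows "adj_card E (insert v A) (insert v A) = adj_card E A A + 2 * adj_card E {v} A"
  using adj_card_Un_Un[of "{v}" A] assms by simp

lemma even_adj_card: "finite A \<Longrightarrow> even (adj_card E A A)"
  by (induction A rule: finite_induct) (simp_all add: adj_card_insert)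

lemma adj_card_lt_imp:
  assumes "finite A" "adj_card E A A < 2 * card A"
  shows "adj_card E A A + 2 \<le> 2 * card A"
proof -
  obtain x where "adj_card E A A = 2 * x" using even_adj_card[OF assms(1)] by (auto elim: evenE)
  with assms(2) show ?thesis by simp
qed

text \<open>Grow a subset from one vertex; each cut supplies a vertex that brings at least one new
  edge. So there are at least \<open>card S - 1\<close> edges.\<close>

lemma connected_in_adj_card:
  assumes "finite S" "connected_in E S"
  shows "2 * card S \<le> adj_card E S S + 2"
proof -
  have "\<exists>A\<subseteq>S. card A = Suc j \<and> 2 * Suc j \<le> adj_card E A A + 2" if "Suc j \<le> card S" for j
    using that
  proof (induction j)
    case 0
    obtain x where "x \<in> S" using assms(2) by (auto simp: connected_in_def)
    then show ?case by (intro exI[of _ "{x}"]) simp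
  next
    case (Suc j)
    then obtain A where A: "A \<subseteq> S" "card A = Suc j" "2 * Suc j \<le> adj_card E A A + 2" by auto
    have fA: "finite A" using A(1) assms(1) finite_subset by blast
    have "A \<noteq> {}" "A \<noteq> S" using A Suc.prems by auto
    then obtain a b where ab: "a \<in> A" "b \<in> S - A" "E a b"
      using assms(2) A(1) unfolding connected_in_def by meson
    have "adj_card E {b} A \<ge> 1"
      using adj_card_ge_1[of "{b}" A b a E] fA ab adj_sym by auto
    then have "2 * Suc (Suc j) \<le> adj_card E (insert b A) (insert b A) + 2"
      using adj_card_insert[of A b] fA ab A(3) by simp
    moreover have "insert b A \<subseteq> S" "card (insert b A) = Suc (Suc j)"
      using ab A fA by auto
    ultimately show ?case by blast
  qed
  from this[of "card S - 1"] obtain A where A: "A \<subseteq> S" "card A = card S"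
      "2 * card S \<le> adj_card E A A + 2"
    using assms by (cases "card S") (auto simp: connected_in_def)
  then have "A = S" using assms(1) card_subset_eq by blast
  with A(3) show ?thesis by simp
qed

lemma connected_in_subset_closed:
  assumes "connected_in E S" "S \<subseteq> V" "nbhd E V T = {}" "S \<inter> T \<noteq> {}"
  shows "S \<subseteq> T"
proof (rule ccontr)
  assume "\<not> S \<subseteq> T"
  then have "S \<inter> T \<noteq> S" by auto
  moreover have "S \<inter> T \<subseteq> S" by auto
  ultimately obtain a b where "a \<in> S \<inter> T" "b \<in> S - S \<inter> T" "E a b"
    using assms(1,4) unfolding connected_in_def by meson
  then show False using assms(2,3) by (auto simp: nbhd_eq_empty_iff)
qed

lemma connected_closed_eq:
  assumes "connected_in E S" "S \<subseteq> V" "nbhd E V S = {}" "connected_in E T" "T \<subseteq> V" "nbhd E V T = {}"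
    "S \<inter> T \<noteq> {}"
  shows "S = T"
  using connected_in_subset_closed[OF assms(1,2,6,7)] connected_in_subset_closed[OF assms(4,5,3)] assms(7)
  by auto

text \<open>A cut without edges splits a disconnected union of components into smaller unions of
  components, so descent ends in a single component.\<close>

lemma closed_contains_connected_closed:
  assumes "finite R" "R \<noteq> {}" "R \<subseteq> V" "nbhd E V R = {}"
  shows "\<exists>T\<subseteq>R. connected_in E T \<and> nbhd E V T = {}"
  using assms
proof (induction R rule: finite_psubset_induct)
  case (psubset R)
  show ?case
  proof (cases "connected_in E R")
    case True
    then show ?thesis using psubset.prems by blast
  next
    case False
    then obtain A where A: "A \<subseteq> R" "A \<noteq> {}" "A \<noteq> R" "\<forall>a\<in>A. \<forall>b\<in>R - A. \<not> E a b"
      using psubset.prems(1) unfolding connected_in_def by blast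
    have "nbhd E V A = {}"
      unfolding nbhd_eq_empty_iff
    proof (intro ballI)
      fix s v assume "s \<in> A" "v \<in> V - A"
      then show "\<not> E s v"
        using A(1,4) psubset.prems(3) by (cases "v \<in> R") (auto simp: nbhd_eq_empty_iff)
    qed
    moreover have "A \<subset> R" "A \<subseteq> V" using A psubset.prems(2) by auto
    ultimately obtain T where "T \<subseteq> A" "connected_in E T \<and> nbhd E V T = {}"
      using psubset.IH[of A] A(2) by auto
    then show ?thesis using A(1) by blast
  qed
qed

lemma adj_card_closed_split:
  assumes "finite V" "S \<subseteq> V" "nbhd E V S = {}"
  shows "adj_card E V V = adj_card E S S + adj_card E (V - S) (V - S)"
proof -
  have fin: "finite S" "finite (V - S)" using assms finite_subset by auto
  have "adj_card E S (V - S) = 0"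
    using assms(3) by (auto simp: adj_card_eq_0_iff[OF fin] nbhd_eq_empty_iff)
  then show ?thesis
    using adj_card_Un_Un[of S "V - S"] fin assms(2) by (simp add: Un_absorb1)
qed

end

section \<open>Shortest cycles\<close>

text \<open>A cycle appears as a smallest nonempty vertex set with at least as many edges as
  vertices; \<open>deg_eq_2\<close> recovers that each of its vertices has exactly two neighbours in
  it.\<close>

locale shortest_cycle = simple_adj E for E :: "'a \<Rightarrow> 'a \<Rightarrow> bool" +
  fixes V C :: "'a set"
  assumes fin: "finite V" and C_subset: "C \<subseteq> V" and C_nonempty: "C \<noteq> {}"
    and C_dense: "2 * card C \<le> adj_card E C C"
    and smaller_sparse: "\<And>W. W \<subseteq> V \<Longrightarrow> W \<noteq> {} \<Longrightarrow> card W < card C \<Longrightarrow> adj_card E W W < 2 * card W"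
begin

lemma finite_sub: "W \<subseteq> V \<Longrightarrow> finite W"
  using fin finite_subset by blast

lemma finite_C: "finite C"
  using C_subset finite_sub by simp

lemma smaller_sparse': "W \<subseteq> V \<Longrightarrow> W \<noteq> {} \<Longrightarrow> card W < card C \<Longrightarrow> adj_card E W W + 2 \<le> 2 * card W"
  using adj_card_lt_imp smaller_sparse finite_sub by simp

lemma proper_sparse: "A \<subseteq> C \<Longrightarrow> A \<noteq> C \<Longrightarrow> A \<noteq> {} \<Longrightarrow> adj_card E A A + 2 \<le> 2 * card A"
  using smaller_sparse' C_subset finite_C psubset_card_mono[of C A] by blast

text \<open>What is left after deleting \<open>v\<close> is sparse, so \<open>v\<close> must carry
  at least two edges. The second bound keeps track of a surplus of edges, for
  \<open>adj_card_C\<close>.\<close>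

lemma deg_ge_2:
  assumes "v \<in> C"
  shows "adj_card E {v} C \<ge> 2" and "adj_card E C C + 4 \<le> 2 * card C + 2 * adj_card E {v} C"
proof -
  let ?A = "C - {v}"
  have fA: "finite ?A" and ins: "insert v ?A = C" and cA: "card C = Suc (card ?A)"
    using finite_C assms card.remove[OF finite_C assms] by blast+
  have split: "adj_card E C C = adj_card E ?A ?A + 2 * adj_card E {v} ?A"
    using adj_card_insert[of ?A v] fA ins by simp
  have "adj_card E {v} C = adj_card E {v} ?A"
    using assms adj_card_Un_right[of "{v}" ?A "{v}"] fA ins by simp
  moreover have "?A \<noteq> {}"
  proof
    assume "?A = {}"
    then have "C = {v}" using assms by auto
    then show False using C_dense by simp
  qed
  moreover have "?A \<subseteq> C" "?A \<noteq> C" using assms by auto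
  ultimately show "adj_card E C C + 4 \<le> 2 * card C + 2 * adj_card E {v} C"
    using proper_sparse[of ?A] split cA by linarith
  then show "adj_card E {v} C \<ge> 2" using C_dense by linarith
qed

lemma card_C_ge_3: "card C \<ge> 3"
proof -
  obtain v where v: "v \<in> C" using C_nonempty by auto
  have "{b \<in> C. E v b} \<subseteq> C - {v}" using adj_irrefl by auto
  then have "card {b \<in> C. E v b} \<le> card (C - {v})"
    using finite_C by (intro card_mono) auto
  then show ?thesis
    using deg_ge_2(1)[OF v] v finite_C by (simp add: adj_card_singleton)
qed

text \<open>A surplus \<open>x\<close> would raise every degree to at least
  \<open>2 + x / 2\<close>; the degree sum then gives \<open>card C * x \<le> 2 * x\<close>,
  impossible for \<open>x > 0\<close> as \<open>card C \<ge> 3\<close>.\<close>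

lemma adj_card_C: "adj_card E C C = 2 * card C"
proof -
  obtain x where x: "adj_card E C C = 2 * card C + x"
    using C_dense le_Suc_ex by blast
  have "card C * (x + 4) = (\<Sum>v\<in>C. x + 4)" by simp
  also have "\<dots> \<le> (\<Sum>v\<in>C. 2 * adj_card E {v} C)"
    by (rule sum_mono) (use deg_ge_2(2) x in fastforce)
  also have "\<dots> = 2 * (2 * card C + x)"
    using adj_card_sum[OF finite_C finite_C, of E] x by (simp add: sum_distrib_left)
  finally have "card C * x \<le> 2 * x" by (simp add: algebra_simps)
  moreover have "3 * x \<le> card C * x" using card_C_ge_3 by (rule mult_right_mono) simp
  ultimately have "3 * x \<le> 2 * x" by (rule order_trans[rotated])
  then show ?thesis using x by simp
qed

lemma deg_eq_2:
  assumes "v \<in> C"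
  shows "adj_card E {v} C = 2"
proof (rule ccontr)
  assume "adj_card E {v} C \<noteq> 2"
  then have "2 < adj_card E {v} C" using deg_ge_2(1)[OF assms] by simp
  then have "(\<Sum>v\<in>C. 2) < (\<Sum>v\<in>C. adj_card E {v} C)"
    using assms deg_ge_2(1) by (intro sum_strict_mono_ex1 finite_C) auto
  then show False
    using adj_card_sum[OF finite_C finite_C, of E] adj_card_C by simp
qed

lemma adj_card_subset_C: "A \<subseteq> C \<Longrightarrow> adj_card E A C = 2 * card A"
  using adj_card_sum[of A C E] finite_C finite_subset[of A C] deg_eq_2 by (simp add: subset_iff)

text \<open>Two distinct vertices cut the cycle into two arcs with \<open>card C + 2\<close>
  vertices in total, so the shorter one serves. Arcs are recognised by edge counts: \<open>A\<close>
  is a least set through both ends with at most one edge fewer than vertices.\<close>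

lemma exists_short_arc:
  assumes "x \<in> C" "y \<in> C"
  shows "\<exists>A\<subseteq>C. x \<in> A \<and> y \<in> A \<and> 2 * card A \<le> adj_card E A A + 2 \<and> 2 * card A \<le> card C + 2"
proof (cases "x = y")
  case True
  then show ?thesis using assms card_C_ge_3 by (intro exI[of _ "{x}"]) simp
next
  case False
  define P where "P A \<longleftrightarrow> A \<subseteq> C \<and> x \<in> A \<and> y \<in> A \<and> 2 * card A \<le> adj_card E A A + 2" for A
  have "P C" using assms C_dense by (simp add: P_def)
  then obtain A where A: "P A" and min: "\<And>B. P B \<Longrightarrow> card A \<le> card B"
    using ex_has_least_nat[of P C card] by blast
  have fA: "finite A" and AC: "A \<subseteq> C" "x \<in> A" "y \<in> A"
    using A finite_C finite_subset unfolding P_def by blast+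
  show ?thesis
  proof (cases "A = C")
    case True
    \<comment> \<open>If \<open>C\<close> itself were least, deleting a third vertex would cost one
      vertex and two edges, which the condition \<open>P\<close> still permits.\<close>
    have "\<not> C \<subseteq> {x, y}"
    proof
      assume "C \<subseteq> {x, y}"
      then have "card C \<le> card {x, y}" by (intro card_mono) auto
      then show False using card_C_ge_3 False by simp
    qed
    then obtain v where v: "v \<in> C" "v \<noteq> x" "v \<noteq> y" by auto
    have "adj_card E {v} (C - {v}) = adj_card E {v} C"
      using v(1) finite_C adj_card_Un_right[of "{v}" "C - {v}" "{v}"] by (simp add: insert_absorb)
    then have "adj_card E C C = adj_card E (C - {v}) (C - {v}) + 2 * 2"
      using adj_card_insert[of "C - {v}" v] v(1) finite_C deg_eq_2[OF v(1)] by (simp add: insert_absorb)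
    moreover have cC: "card C = Suc (card (C - {v}))"
      using card.remove[OF finite_C v(1)] .
    ultimately have "2 * card (C - {v}) \<le> adj_card E (C - {v}) (C - {v}) + 2"
      using adj_card_C by linarith
    then have "P (C - {v})" using v assms unfolding P_def by blast
    then have "card A \<le> card (C - {v})" by (rule min)
    then have False unfolding True using cC by linarith
    then show ?thesis ..
  next
    case neq: False
    \<comment> \<open>\<open>A\<close> and \<open>B\<close> are the two arcs between \<open>x\<close> and \<open>y\<close>.\<close>
    define B where "B = (C - A) \<union> {x, y}"
    define I where "I = A - {x, y}"
    have eA: "adj_card E A A + 2 = 2 * card A"
      using A proper_sparse[OF AC(1) neq] AC(2) unfolding P_def by force
    have fI: "finite I" "finite B" "finite (C - A)" using fA finite_C by (auto simp: I_def B_def)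
    \<comment> \<open>An inner vertex with fewer than two neighbours in \<open>A\<close> could be
      deleted without violating \<open>P\<close>.\<close>
    have inner: "adj_card E {v} A \<ge> 2" if "v \<in> I" for v
    proof (rule ccontr)
      assume "\<not> 2 \<le> adj_card E {v} A"
      moreover have ins: "insert v (A - {v}) = A" using that by (auto simp: I_def)
      moreover have "adj_card E {v} A = adj_card E {v} (A - {v})"
        using ins fA adj_card_Un_right[of "{v}" "A - {v}" "{v}"] by simp
      ultimately have "adj_card E A A \<le> adj_card E (A - {v}) (A - {v}) + 2"
        using adj_card_insert[of "A - {v}" v] fA by simp
      moreover have cA: "card A = Suc (card (A - {v}))"
        using that card.remove[OF fA, of v] by (auto simp: I_def)
      ultimately have "2 * card (A - {v}) \<le> adj_card E (A - {v}) (A - {v}) + 2"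
        using eA by linarith
      then have "P (A - {v})" using AC that by (auto simp: P_def I_def)
      then show False using min[of "A - {v}"] cA by linarith
    qed
    \<comment> \<open>Both cycle edges at an inner vertex stay in \<open>A\<close>. Thus
      \<open>B\<close> contains every edge of \<open>C\<close> that does not lie inside
      \<open>A\<close>.\<close>
    have noI: "adj_card E {v} (C - A) = 0" if "v \<in> I" for v
      using adj_card_Un_right[of A "C - A" "{v}"] inner[OF that] deg_eq_2[of v] fA fI that AC
      by (auto simp: I_def Un_absorb1)
    have "adj_card E I (C - A) = 0"
      using adj_card_sum[OF fI(1,3), of E] noI by simp
    have eq1: "A = I \<union> {x, y}" using AC by (auto simp: I_def)
    have "adj_card E A (C - A) = adj_card E {x, y} (C - A)"
      using adj_card_Un_left[of I "{x, y}" "C - A" E] fI \<open>adj_card E I (C - A) = 0\<close>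
      by (subst eq1) (auto simp: I_def)
    moreover have "C = A \<union> (C - A)" using AC by auto
    then have "adj_card E C C = adj_card E A A + adj_card E (C - A) (C - A) + 2 * adj_card E A (C - A)"
      using adj_card_Un_Un[of A "C - A"] fA fI by simp
    moreover have "adj_card E B B = adj_card E (C - A) (C - A) + adj_card E {x, y} {x, y}
        + 2 * adj_card E {x, y} (C - A)"
      using adj_card_Un_Un[of "C - A" "{x, y}"] fI AC adj_card_commute[of "C - A" "{x, y}"]
      by (simp add: B_def)
    moreover have cB: "card B = card (C - A) + 2"
      using AC False fI by (auto simp: B_def)
    moreover have cC: "card C = card A + card (C - A)"
      using AC fA finite_C by (metis card_Diff_subset card_mono le_add_diff_inverse)
    ultimately have "2 * card B \<le> adj_card E B B + 2"
      using eA adj_card_C by simp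
    then have "P B" using AC assms by (auto simp: P_def B_def)
    from min[OF this] have "2 * card A \<le> card C + 2" using cB cC by simp
    then show ?thesis using A unfolding P_def by blast
  qed
qed

text \<open>A small set attached to the cycle by two edges would close a cycle shorter than \<open>C\<close> along
  the shorter of the two arcs.\<close>

lemma small_attached:
  assumes "D \<subseteq> V - C" "2 * card D + 3 \<le> card C"
  shows "adj_card E D D + 2 * adj_card E D C \<le> 2 * card D"
proof -
  have "finite D" using assms(1) finite_sub by blast
  then show ?thesis using assms
  proof (induction D rule: finite_psubset_induct)
    case (psubset D)
    have DV: "D \<subseteq> V" using psubset.prems by auto
    show ?case
    proof (cases "D = {}")
      case ne: False
      show ?thesis
      proof (cases "connected_in E D")
        case False
        then obtain A where A: "A \<subseteq> D" "A \<noteq> {}" "A \<noteq> D" "\<forall>a\<in>A. \<forall>b\<in>D - A. \<not> E a b"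
          using ne unfolding connected_in_def by blast
        let ?B = "D - A"
        have f: "finite A" "finite ?B" using A psubset.hyps finite_subset by blast+
        have e0: "adj_card E A ?B = 0" using A(4) by (simp add: adj_card_eq_0_iff f)
        have D: "D = A \<union> ?B" using A by auto
        have c: "card D = card A + card ?B"
          using A f psubset.hyps by (metis card_Diff_subset card_mono le_add_diff_inverse)
        have "adj_card E D D = adj_card E A A + adj_card E ?B ?B"
          using adj_card_Un_Un[of A ?B] f e0 D by simp
        moreover have "adj_card E D C = adj_card E A C + adj_card E ?B C"
          using adj_card_Un_left[of A ?B C E] f finite_C D by simp
        moreover have "adj_card E A A + 2 * adj_card E A C \<le> 2 * card A"
          using psubset.IH[of A] A psubset.prems c by auto
        moreover have "?B \<subset> D" using A by auto
        then have "adj_card E ?B ?B + 2 * adj_card E ?B C \<le> 2 * card ?B"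
          using psubset.IH[of ?B] psubset.prems c by auto
        ultimately show ?thesis using c by simp
      next
        case True
        have sp: "adj_card E D D + 2 \<le> 2 * card D"
          using smaller_sparse'[OF DV ne] psubset.prems by simp
        show ?thesis
        proof (rule ccontr)
          assume "\<not> ?thesis"
          then have "adj_card E D C \<ge> 2" using sp by simp
          \<comment> \<open>Two distinct edges from \<open>D\<close> to the cycle; their ends on it
            may coincide, which \<open>exists_short_arc\<close> allows.\<close>
          then obtain p q where pq: "p \<in> {(a, b). a \<in> D \<and> b \<in> C \<and> E a b}"
              "q \<in> {(a, b). a \<in> D \<and> b \<in> C \<and> E a b}" "p \<noteq> q"
            unfolding adj_card_def using card_le_Suc0_iff_eq[OF adj_card_pairs_finite[OF psubset.hyps finite_C, of E]]
            by (metis (no_types, lifting) not_less_eq_eq numeral_2_eq_2)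
          then have "snd p \<in> C" "snd q \<in> C" by auto
          from exists_short_arc[OF this] obtain A where A: "A \<subseteq> C" "snd p \<in> A" "snd q \<in> A"
              "2 * card A \<le> adj_card E A A + 2" "2 * card A \<le> card C + 2"
            by blast
          have fA: "finite A" using A finite_C finite_subset by blast
          have "card {p, q} \<le> adj_card E D A"
            unfolding adj_card_def
            by (rule card_mono[OF adj_card_pairs_finite[OF psubset.hyps fA]]) (use pq A in auto)
          then have "2 \<le> adj_card E D A" using pq by simp
          moreover have "2 * card D \<le> adj_card E D D + 2"
            using connected_in_adj_card[OF psubset.hyps True] .
          moreover have dis: "D \<inter> A = {}" using psubset.prems A by auto
          ultimately have "2 * card (D \<union> A) \<le> adj_card E (D \<union> A) (D \<union> A)"
            using adj_card_Un_Un[OF psubset.hyps fA dis] A card_Un_disjoint[OF psubset.hyps fA dis] by simp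
          \<comment> \<open>Adding \<open>2 * card D + 3 \<le> card C\<close> and
            \<open>2 * card A \<le> card C + 2\<close> gives the strict inequality.\<close>
          moreover have "card (D \<union> A) < card C"
            using card_Un_disjoint[OF psubset.hyps fA dis] A psubset.prems by simp
          moreover have "D \<union> A \<subseteq> V" "D \<union> A \<noteq> {}" using DV A C_subset ne by auto
          ultimately show False using smaller_sparse[of "D \<union> A"] by linarith
        qed
      qed
    qed simp
  qed
qed

text \<open>It suffices to count the edges from \<open>S\<close> to \<open>C - S\<close>.
  Connectedness bounds the edges inside \<open>S\<close> from below; degree 2 on \<open>C\<close>
  and \<open>small_attached\<close> bound the edges from \<open>S\<close> to \<open>C\<close> from
  above. This leaves at most two edges, and at most one if \<open>S\<close> avoids
  \<open>C\<close>.\<close>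

lemma nbhd_on_cycle:
  assumes "S \<subseteq> V" "connected_in E S" "card S < card C" "2 * card (S - C) + 3 \<le> card C"
  shows "card (nbhd E V S \<inter> C) \<le> (if S \<inter> C = {} then 1 else 2)"
proof -
  let ?D = "S - C" and ?A = "S \<inter> C"
  have fS: "finite S" and fD: "finite ?D" and fA: "finite ?A" and fR: "finite (C - ?A)"
    using assms finite_sub finite_C by auto
  have att: "adj_card E ?D ?D + 2 * adj_card E ?D C \<le> 2 * card ?D"
    using small_attached assms by blast
  have con: "2 * card S \<le> adj_card E S S + 2"
    using connected_in_adj_card fS assms by blast
  show ?thesis
  proof (cases "?A = {}")
    case True
    then have "?D = S" by auto
    then have "adj_card E S C \<le> 1" using att con by simp
    moreover have "card (nbhd E V S \<inter> C) \<le> adj_card E S C"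
      using True by (intro card_nbhd_Int_le fS finite_C) auto
    ultimately show ?thesis using True by simp
  next
    case False
    have "?A \<noteq> C" using assms(3) fS by (metis Int_lower1 card_mono linorder_not_le)
    then have spA: "adj_card E ?A ?A + 2 \<le> 2 * card ?A"
      using proper_sparse False by blast
    have DA: "?D \<inter> ?A = {}" and S: "?D \<union> ?A = S" and C: "?A \<union> (C - ?A) = C" by auto
    have eS: "adj_card E S S = adj_card E ?D ?D + adj_card E ?A ?A + 2 * adj_card E ?D ?A"
      using adj_card_Un_Un[OF fD fA DA] unfolding S by simp
    have cS: "card S = card ?D + card ?A"
      using card_Un_disjoint[OF fD fA DA] unfolding S by simp
    have eDC: "adj_card E ?D C = adj_card E ?D ?A + adj_card E ?D (C - ?A)"
      using adj_card_Un_right[of ?A "C - ?A" ?D] fA fR fD unfolding C by blast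
    have eAC: "2 * card ?A = adj_card E ?A ?A + adj_card E ?A (C - ?A)"
      using adj_card_Un_right[of ?A "C - ?A" ?A] fA fR adj_card_subset_C[of ?A] unfolding C by auto
    have "adj_card E S (C - ?A) = adj_card E ?D (C - ?A) + adj_card E ?A (C - ?A)"
      using adj_card_Un_left[OF fD fA fR DA, of E] unfolding S by simp
    then have "adj_card E S (C - ?A) \<le> 2"
      using att con spA eS cS eDC eAC by linarith
    moreover have "card (nbhd E V S \<inter> (C - ?A)) \<le> adj_card E S (C - ?A)"
      by (intro card_nbhd_Int_le fS fR) auto
    moreover have "nbhd E V S \<inter> C = nbhd E V S \<inter> (C - ?A)"
      by (auto simp: nbhd_def)
    ultimately show ?thesis using False by simp
  qed
qed

end

section \<open>Copies of induced subgraphs and the deck\<close>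

definition induced_iso ::
  "('a \<Rightarrow> 'a \<Rightarrow> bool) \<Rightarrow> 'a set \<Rightarrow> ('b \<Rightarrow> 'b \<Rightarrow> bool) \<Rightarrow> 'b set \<Rightarrow> bool" where
  "induced_iso E S E' S' \<longleftrightarrow> (\<exists>f. bij_betw f S S' \<and> (\<forall>x\<in>S. \<forall>y\<in>S. E x y = E' (f x) (f y)))"

definition copies ::
  "('a \<Rightarrow> 'a \<Rightarrow> bool) \<Rightarrow> 'a set \<Rightarrow> ('b \<Rightarrow> 'b \<Rightarrow> bool) \<Rightarrow> 'b set \<Rightarrow> 'a set set" where
  "copies E V E' T = {S. S \<subseteq> V \<and> induced_iso E S E' T}"

lemma induced_iso_refl: "induced_iso E S E S"
  unfolding induced_iso_def by (rule exI[of _ id]) simp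

lemma induced_iso_sym:
  assumes "induced_iso E S E' S'"
  shows "induced_iso E' S' E S"
proof -
  obtain f where f: "bij_betw f S S'" "\<And>x y. x \<in> S \<Longrightarrow> y \<in> S \<Longrightarrow> E x y = E' (f x) (f y)"
    using assms by (auto simp: induced_iso_def)
  have inv: "inv_into S f y \<in> S" "f (inv_into S f y) = y" if "y \<in> S'" for y
    using f(1) that by (auto simp: bij_betw_def inv_into_into f_inv_into_f)
  show ?thesis
    unfolding induced_iso_def
    using f(2) inv bij_betw_inv_into[OF f(1)] by (intro exI[of _ "inv_into S f"]) simp
qed

lemma induced_iso_trans:
  assumes "induced_iso E S E' S'" "induced_iso E' S' E'' S''"
  shows "induced_iso E S E'' S''"
proof -
  obtain f where f: "bij_betw f S S'" "\<And>x y. x \<in> S \<Longrightarrow> y \<in> S \<Longrightarrow> E x y = E' (f x) (f y)"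
    using assms(1) by (auto simp: induced_iso_def)
  obtain g where g: "bij_betw g S' S''" "\<And>x y. x \<in> S' \<Longrightarrow> y \<in> S' \<Longrightarrow> E' x y = E'' (g x) (g y)"
    using assms(2) by (auto simp: induced_iso_def)
  have "f x \<in> S'" if "x \<in> S" for x using f(1) that by (auto simp: bij_betw_def)
  then show ?thesis
    unfolding induced_iso_def
    using f(2) g(2) bij_betw_trans[OF f(1) g(1)] by (intro exI[of _ "g \<circ> f"]) simp
qed

lemma induced_iso_card: "induced_iso E S E' S' \<Longrightarrow> card S = card S'"
  by (auto simp: induced_iso_def bij_betw_same_card)

lemma induced_iso_adj_card:
  assumes "induced_iso E S E' S'"
  shows "adj_card E S S = adj_card E' S' S'"
proof -
  obtain f where f: "bij_betw f S S'" "\<And>x y. x \<in> S \<Longrightarrow> y \<in> S \<Longrightarrow> E x y = E' (f x) (f y)"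
    using assms by (auto simp: induced_iso_def)
  have "bij_betw (map_prod f f) {(a, b). a \<in> S \<and> b \<in> S \<and> E a b} {(a, b). a \<in> S' \<and> b \<in> S' \<and> E' a b}"
    using f by (fastforce simp: bij_betw_def inj_on_def image_iff)
  then show ?thesis
    unfolding adj_card_def by (rule bij_betw_same_card)
qed

lemma induced_iso_connected_in:
  assumes "induced_iso E S E' S'" "connected_in E S"
  shows "connected_in E' S'"
proof -
  obtain f where f: "bij_betw f S S'" "\<And>x y. x \<in> S \<Longrightarrow> y \<in> S \<Longrightarrow> E x y = E' (f x) (f y)"
    using assms by (auto simp: induced_iso_def)
  have S': "S' = f ` S" using f(1) by (simp add: bij_betw_def)
  show ?thesis
    unfolding connected_in_def
  proof (intro conjI allI impI)
    show "S' \<noteq> {}" using assms(2) S' by (auto simp: connected_in_def)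
  next
    fix A assume A: "A \<subseteq> S'" "A \<noteq> {}" "A \<noteq> S'"
    let ?B = "{x \<in> S. f x \<in> A}"
    have "?B \<noteq> {}" "?B \<noteq> S" using A unfolding S' by auto
    then obtain a b where ab: "a \<in> ?B" "b \<in> S - ?B" "E a b"
      using assms(2) unfolding connected_in_def by (metis (no_types, lifting) mem_Collect_eq subsetI)
    then show "\<exists>a\<in>A. \<exists>b\<in>S' - A. E' a b"
      using f(2) unfolding S' by blast
  qed
qed

lemma induced_iso_card_degree:
  assumes "induced_iso E S E' S'"
  shows "card {v \<in> S. adj_card E {v} S = i} = card {v \<in> S'. adj_card E' {v} S' = i}"
proof -
  obtain f where f: "bij_betw f S S'" "\<And>x y. x \<in> S \<Longrightarrow> y \<in> S \<Longrightarrow> E x y = E' (f x) (f y)"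
    using assms by (auto simp: induced_iso_def)
  have S': "S' = f ` S" and inj: "inj_on f S" using f(1) by (simp_all add: bij_betw_def)
  have deg: "adj_card E {v} S = adj_card E' {f v} S'" if "v \<in> S" for v
  proof -
    have "f ` {b \<in> S. E v b} = {b \<in> S'. E' (f v) b}"
      using f(2) that unfolding S' by auto
    then show ?thesis
      using card_image[OF inj_on_subset[OF inj, of "{b \<in> S. E v b}"]]
      by (simp add: adj_card_singleton)
  qed
  have "f ` {v \<in> S. adj_card E {v} S = i} = {v \<in> S'. adj_card E' {v} S' = i}"
    using deg unfolding S' by auto
  then show ?thesis
    using card_image[OF inj_on_subset[OF inj, of "{v \<in> S. adj_card E {v} S = i}"]] by simp
qed

lemma finite_copies: "finite V \<Longrightarrow> finite (copies E V E' T)"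
  unfolding copies_def by (rule finite_subset[of _ "Pow V"]) auto

text \<open>A pair \<open>(S, W)\<close> lies inside a card iff \<open>W\<close> does, so the number of pairs is determined by the deck.\<close>

definition star_pairs where
  "star_pairs E V E' T j = {(S, W). S \<subseteq> W \<and> W \<subseteq> V \<and> card W = j \<and> induced_iso E S E' T
    \<and> (\<forall>w\<in>W - S. \<exists>s\<in>S. E s w)}"

lemma finite_star_pairs: "finite V \<Longrightarrow> finite (star_pairs E V E' T j)"
  unfolding star_pairs_def by (rule finite_subset[of _ "Pow V \<times> Pow V"]) auto

text \<open>Given the copy \<open>S\<close>, the set \<open>W - S\<close> is an arbitrary
  \<open>i\<close>-subset of its neighbourhood.\<close>

lemma card_star_pairs:
  assumes "finite V" "card T + i = j"
  shows "card (star_pairs E V E' T j) = (\<Sum>S\<in>copies E V E' T. card (nbhd E V S) choose i)"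
proof -
  let ?W = "\<lambda>S. {W. S \<subseteq> W \<and> W \<subseteq> V \<and> card W = j \<and> (\<forall>w\<in>W - S. \<exists>s\<in>S. E s w)}"
  have "star_pairs E V E' T j = Sigma (copies E V E' T) ?W"
    by (auto simp: star_pairs_def copies_def)
  moreover have "card (?W S) = card (nbhd E V S) choose i" if S: "S \<in> copies E V E' T" for S
  proof -
    have fS: "finite S" "S \<subseteq> V" and cS: "card S = card T"
      using S assms(1) finite_subset induced_iso_card by (auto simp: copies_def)
    have "bij_betw (\<lambda>N. S \<union> N) {N. N \<subseteq> nbhd E V S \<and> card N = i} (?W S)"
    proof (rule bij_betw_byWitness[where f' = "\<lambda>W. W - S"])
      show "(\<lambda>N. S \<union> N) ` {N. N \<subseteq> nbhd E V S \<and> card N = i} \<subseteq> ?W S"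
      proof clarify
        fix N assume N: "N \<subseteq> nbhd E V S" "i = card N"
        then have "S \<inter> N = {}" "finite N" "N \<subseteq> V"
          using assms(1) finite_subset[OF N(1)] by (auto simp: nbhd_def)
        then show "S \<subseteq> S \<union> N \<and> S \<union> N \<subseteq> V \<and> card (S \<union> N) = j \<and> (\<forall>w\<in>S \<union> N - S. \<exists>s\<in>S. E s w)"
          using N fS cS assms(2) by (auto simp: card_Un_disjoint nbhd_def)
      qed
      show "(\<lambda>W. W - S) ` ?W S \<subseteq> {N. N \<subseteq> nbhd E V S \<and> card N = i}"
        using fS cS assms(2) by (auto simp: nbhd_def card_Diff_subset)
    qed (auto simp: nbhd_def)
    then have "card (?W S) = card {N. N \<subseteq> nbhd E V S \<and> card N = i}"
      by (rule bij_betw_same_card[symmetric])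
    then show ?thesis using n_subsets[of "nbhd E V S" i] assms(1) by simp
  qed
  moreover have "finite (?W S)" for S
    by (rule finite_subset[of _ "Pow V"]) (use assms(1) in auto)
  ultimately show ?thesis
    by (simp add: card_SigmaI finite_copies assms(1))
qed

lemma card_star_pairs_le:
  assumes "induced_iso E U E' U'" "finite U" "finite U'"
  shows "card (star_pairs E U E0 T j) \<le> card (star_pairs E' U' E0 T j)"
proof -
  obtain f where f: "bij_betw f U U'" "\<And>x y. x \<in> U \<Longrightarrow> y \<in> U \<Longrightarrow> E x y = E' (f x) (f y)"
    using assms(1) by (auto simp: induced_iso_def)
  have inj: "inj_on f U" and img: "U' = f ` U" using f(1) by (simp_all add: bij_betw_def)
  show ?thesis
  proof (rule card_inj_on_le)
    show "inj_on (\<lambda>(S, W). (f ` S, f ` W)) (star_pairs E U E0 T j)"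
    proof (rule inj_onI, clarify)
      fix S W S' W' assume "(S, W) \<in> star_pairs E U E0 T j" "(S', W') \<in> star_pairs E U E0 T j"
        and eq: "f ` S = f ` S'" "f ` W = f ` W'"
      then have "S \<subseteq> U" "W \<subseteq> U" "S' \<subseteq> U" "W' \<subseteq> U" by (auto simp: star_pairs_def)
      then show "S = S' \<and> W = W'" using eq by (simp add: inj_on_image_eq_iff[OF inj])
    qed
    show "(\<lambda>(S, W). (f ` S, f ` W)) ` star_pairs E U E0 T j \<subseteq> star_pairs E' U' E0 T j"
    proof clarify
      fix S W assume "(S, W) \<in> star_pairs E U E0 T j"
      then have SW: "S \<subseteq> W" "W \<subseteq> U" "card W = j" "induced_iso E S E0 T"
          "\<forall>w\<in>W - S. \<exists>s\<in>S. E s w"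
        by (auto simp: star_pairs_def)
      have "bij_betw f S (f ` S)" 
        using inj_on_subset[OF inj, of S] SW(1,2) by (auto simp: bij_betw_def)
      then have "induced_iso E S E' (f ` S)"
        unfolding induced_iso_def using f(2) SW by blast
      then have "induced_iso E' (f ` S) E0 T"
        using SW(4) induced_iso_sym induced_iso_trans by blast
      moreover have "card (f ` W) = j"
        using SW card_image[OF inj_on_subset[OF inj SW(2)]] by simp
      moreover have "\<exists>s\<in>f ` S. E' s w" if w: "w \<in> f ` W - f ` S" for w
      proof -
        obtain x where "x \<in> W - S" "w = f x" using w by blast
        then obtain s where "s \<in> S" "E s x" using SW(5) by blast
        then show ?thesis using f(2)[of s x] SW \<open>x \<in> W - S\<close> \<open>w = f x\<close> by blast
      qed
      ultimately show "(f ` S, f ` W) \<in> star_pairs E' U' E0 T j"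
        using SW unfolding star_pairs_def img by blast
    qed
  qed (simp add: finite_star_pairs assms)
qed

lemma card_star_pairs_iso:
  assumes "induced_iso E U E' U'" "finite U" "finite U'"
  shows "card (star_pairs E U E0 T j) = card (star_pairs E' U' E0 T j)"
  using card_star_pairs_le[OF assms] card_star_pairs_le[OF induced_iso_sym[OF assms(1)] assms(3,2)]
  by (rule antisym)

lemma card_supersets:
  assumes "finite V" "W \<subseteq> V" "card W = j" "j \<le> k"
  shows "card {U. W \<subseteq> U \<and> U \<subseteq> V \<and> card U = k} = (card V - j) choose (k - j)"
proof -
  have fW: "finite W" using assms finite_subset by blast
  have "bij_betw (\<lambda>N. W \<union> N) {N. N \<subseteq> V - W \<and> card N = k - j} {U. W \<subseteq> U \<and> U \<subseteq> V \<and> card U = k}"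
  proof (rule bij_betw_byWitness[where f' = "\<lambda>U. U - W"])
    show "(\<lambda>N. W \<union> N) ` {N. N \<subseteq> V - W \<and> card N = k - j} \<subseteq> {U. W \<subseteq> U \<and> U \<subseteq> V \<and> card U = k}"
    proof clarify
      fix N assume N: "N \<subseteq> V - W" "card N = k - j"
      then have "finite N" "W \<inter> N = {}" using assms(1) finite_subset by auto
      then show "W \<subseteq> W \<union> N \<and> W \<union> N \<subseteq> V \<and> card (W \<union> N) = k"
        using N assms fW by (auto simp: card_Un_disjoint)
    qed
    show "(\<lambda>U. U - W) ` {U. W \<subseteq> U \<and> U \<subseteq> V \<and> card U = k} \<subseteq> {N. N \<subseteq> V - W \<and> card N = k - j}"
      using fW assms by (auto simp: card_Diff_subset)
  qed auto
  then have "card {U. W \<subseteq> U \<and> U \<subseteq> V \<and> card U = k} = card {N. N \<subseteq> V - W \<and> card N = k - j}"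
    by (rule bij_betw_same_card[symmetric])
  then show ?thesis
    using n_subsets[of "V - W" "k - j"] assms by (simp add: card_Diff_subset fW)
qed

text \<open>Kelly's double count: every pair lies inside the same number of
  \<open>k\<close>-sets.\<close>

lemma sum_card_star_pairs:
  assumes "finite V" "j \<le> k"
  shows "(\<Sum>U | U \<subseteq> V \<and> card U = k. card (star_pairs E U E' T j))
    = card (star_pairs E V E' T j) * ((card V - j) choose (k - j))"
proof -
  let ?P = "star_pairs E V E' T j" and ?K = "{U. U \<subseteq> V \<and> card U = k}"
  have fK: "finite ?K" by (rule finite_subset[of _ "Pow V"]) (use assms in auto)
  have "(\<Sum>U\<in>?K. card (star_pairs E U E' T j)) = (\<Sum>U\<in>?K. card {p \<in> ?P. snd p \<subseteq> U})"
    by (intro sum.cong refl arg_cong[of _ _ card]) (auto simp: star_pairs_def)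
  also have "\<dots> = (\<Sum>U\<in>?K. \<Sum>p | p \<in> ?P \<and> snd p \<subseteq> U. 1)" by simp
  also have "\<dots> = (\<Sum>p\<in>?P. \<Sum>U | U \<in> ?K \<and> snd p \<subseteq> U. 1)"
    by (rule sum.swap_restrict) (simp_all add: fK finite_star_pairs assms)
  also have "\<dots> = (\<Sum>p\<in>?P. (card V - j) choose (k - j))"
  proof (rule sum.cong)
    fix p assume "p \<in> ?P"
    then have "snd p \<subseteq> V" "card (snd p) = j" by (auto simp: star_pairs_def)
    from card_supersets[OF assms(1) this assms(2)]
    have "card {U. U \<in> ?K \<and> snd p \<subseteq> U} = (card V - j) choose (k - j)"
      by (simp add: conj_ac)
    then show "(\<Sum>U | U \<in> ?K \<and> snd p \<subseteq> U. 1) = (card V - j) choose (k - j)" by simp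
  qed simp
  finally show ?thesis by simp
qed

section \<open>From isomorphism classes of digraphs to moments\<close>

lemma digraph_iso_induced_iso:
  assumes "digraph_iso G H"
  shows "induced_iso (dominates G) (verts G) (dominates H) (verts H)"
proof -
  obtain f where f: "pre_digraph.digraph_isomorphism G f" "H = app_iso f G"
    using assms by (auto simp: digraph_iso_def)
  have wf: "wf_digraph G" and inj: "inj_on (iso_verts f) (verts G)"
    and ends: "\<And>a. a \<in> arcs G \<Longrightarrow> iso_verts f (tail G a) = iso_tail f (iso_arcs f a)
      \<and> iso_verts f (head G a) = iso_head f (iso_arcs f a)"
    using f(1) by (auto simp: pre_digraph.digraph_isomorphism_def)
  interpret wf_digraph G by fact
  have "dominates G x y = dominates H (iso_verts f x) (iso_verts f y)"
    if xy: "x \<in> verts G" "y \<in> verts G" for x y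
  proof
    assume "dominates G x y"
    then obtain a where "a \<in> arcs G" "tail G a = x" "head G a = y" by auto
    then show "dominates H (iso_verts f x) (iso_verts f y)"
      using ends[of a] by (force simp: arcs_ends_conv f(2) image_iff)
  next
    assume "dominates H (iso_verts f x) (iso_verts f y)"
    then obtain a where a: "a \<in> arcs G" "iso_verts f x = iso_verts f (tail G a)"
        "iso_verts f y = iso_verts f (head G a)"
      using ends by (force simp: arcs_ends_conv f(2))
    then have "x = tail G a" "y = head G a" using inj xy by (auto dest: inj_onD)
    then show "dominates G x y" using a(1) by (auto simp: arcs_ends_conv)
  qed
  moreover have "bij_betw (iso_verts f) (verts G) (verts H)"
    using inj by (simp add: bij_betw_def f(2))
  ultimately show ?thesis unfolding induced_iso_def by blast
qed

text \<open>Star pair counts are isomorphism invariants, so any representative of a class may be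
  used and the sum depends on the deck alone.\<close>

lemma sum_over_deck:
  fixes G :: "('a, 'b) pre_digraph"
  assumes "fin_digraph G"
  shows "(\<Sum>U | U \<subseteq> verts G \<and> card U = k. card (star_pairs (dominates G) U E' T j))
    = (\<Sum>c\<in>#deck k G. card (star_pairs (dominates (SOME K. K \<in> c)) (verts (SOME K. K \<in> c)) E' T j))"
proof -
  interpret fin_digraph G by fact
  have "card (star_pairs (dominates G) U E' T j) =
      card (star_pairs (dominates K) (verts K) E' T j)"
    if U: "U \<subseteq> verts G" and K: "K = (SOME K. K \<in> iso_class (G \<restriction> U))" for U K
  proof -
    have fU: "finite U" using U finite_verts finite_subset by blast
    interpret GU: wf_digraph "G \<restriction> U" by (rule wellformed_induce_subgraph)
    have "fin_digraph (G \<restriction> U)" by unfold_locales (simp_all add: fU)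
    then have "digraph_iso (G \<restriction> U) K"
      using iso_class_nonempty[of "G \<restriction> U"] some_in_eq[of "iso_class (G \<restriction> U)"]
      by (auto simp: K iso_class_def)
    then have "induced_iso (dominates (G \<restriction> U)) U (dominates K) (verts K)"
      using digraph_iso_induced_iso by fastforce
    moreover have "dominates G x y = dominates (G \<restriction> U) x y" if "x \<in> U" "y \<in> U" for x y
      using that by (auto simp: arcs_ends_conv image_iff)
    then have "induced_iso (dominates G) U (dominates (G \<restriction> U)) U"
      unfolding induced_iso_def by (intro exI[of _ id]) simp
    ultimately have iso: "induced_iso (dominates G) U (dominates K) (verts K)"
      by (rule induced_iso_trans[rotated])
    then obtain f where "bij_betw f U (verts K)" by (auto simp: induced_iso_def)
    then have "finite (verts K)" using fU bij_betw_finite by blast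
    then show ?thesis using card_star_pairs_iso[OF iso fU] by simp
  qed
  moreover have "finite {U. U \<subseteq> verts G \<and> card U = k}"
    by (rule finite_subset[of _ "Pow (verts G)"]) auto
  ultimately show ?thesis
    by (simp add: deck_def image_mset.compositionality o_def sum_unfold_sum_mset)
qed

text \<open>Kelly's count gives the number of star pairs up to a binomial factor, which is positive
  since \<open>card T + i \<le> k \<le> card (verts G)\<close>.\<close>

lemma deck_moments:
  assumes "fin_digraph G" "fin_digraph G'" "card (verts G) = card (verts G')" "k \<le> card (verts G)"
    "deck k G = deck k G'" "card T + i \<le> k"
  shows "(\<Sum>S\<in>copies (dominates G) (verts G) E T. card (nbhd (dominates G) (verts G) S) choose i)
    = (\<Sum>S\<in>copies (dominates G') (verts G') E T. card (nbhd (dominates G') (verts G') S) choose i)"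
proof -
  interpret G: fin_digraph G by fact
  interpret G': fin_digraph G' by fact
  let ?c = "(card (verts G) - (card T + i)) choose (k - (card T + i))"
  have "card (star_pairs (dominates G) (verts G) E T (card T + i)) * ?c =
      card (star_pairs (dominates G') (verts G') E T (card T + i)) * ?c"
    using sum_over_deck[OF assms(1), where k = k and E' = E and T = T and j = "card T + i"]
      sum_over_deck[OF assms(2), where k = k and E' = E and T = T and j = "card T + i"] assms
    by (simp add: sum_card_star_pairs)
  moreover have "?c > 0" using assms(4,6) by (simp add: zero_less_binomial_iff)
  ultimately have "card (star_pairs (dominates G) (verts G) E T (card T + i)) =
      card (star_pairs (dominates G') (verts G') E T (card T + i))"
    by simp
  then show ?thesis by (simp add: card_star_pairs)
qed

text \<open>The binomial sums form a triangular system in the fibre sizes. It is solved from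
  \<open>r\<close> downwards: terms with \<open>m < j\<close> vanish, and those with
  \<open>m > j\<close> are already known to agree.\<close>

lemma card_fibres_eq:
  fixes f :: "'a \<Rightarrow> nat" and g :: "'b \<Rightarrow> nat"
  assumes "finite X" "finite Y" "\<And>x. x \<in> X \<Longrightarrow> f x \<le> r" "\<And>y. y \<in> Y \<Longrightarrow> g y \<le> r"
    and moments: "\<And>i. i \<le> r \<Longrightarrow> (\<Sum>x\<in>X. f x choose i) = (\<Sum>y\<in>Y. g y choose i)"
  shows "card {x \<in> X. f x = j} = card {y \<in> Y. g y = j}"
proof -
  have group: "(\<Sum>x\<in>Z. h x choose i) = (\<Sum>j\<le>r. card {x \<in> Z. h x = j} * (j choose i))"
    if "finite Z" "\<And>x. x \<in> Z \<Longrightarrow> h x \<le> r" for i and Z :: "'c set" and h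
  proof -
    have "(\<Sum>x\<in>Z. h x choose i) = (\<Sum>j\<le>r. \<Sum>x | x \<in> Z \<and> h x = j. h x choose i)"
      using that by (intro sum.group[symmetric]) auto
    then show ?thesis by simp
  qed
  have "card {x \<in> X. f x = j} = card {y \<in> Y. g y = j}" if "j \<le> r"
    using that
  proof (induction "r - j" arbitrary: j rule: less_induct)
    case less
    let ?a = "\<lambda>m. card {x \<in> X. f x = m}" and ?b = "\<lambda>m. card {y \<in> Y. g y = m}"
    have "(\<Sum>m\<le>r. ?a m * (m choose j)) = (\<Sum>m\<le>r. ?b m * (m choose j))"
      using moments[OF less.prems] group[OF assms(1,3)] group[OF assms(2,4)] by simp
    then have "?a j + (\<Sum>m\<in>{..r} - {j}. ?a m * (m choose j)) = ?b j + (\<Sum>m\<in>{..r} - {j}. ?b m * (m choose j))"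
      using less.prems by (simp add: sum.remove[of "{..r}" j])
    moreover have "(\<Sum>m\<in>{..r} - {j}. ?a m * (m choose j)) = (\<Sum>m\<in>{..r} - {j}. ?b m * (m choose j))"
    proof (rule sum.cong)
      fix m assume m: "m \<in> {..r} - {j}"
      show "?a m * (m choose j) = ?b m * (m choose j)"
      proof (cases "m < j")
        case False
        then show ?thesis using less.hyps[of m] m by auto
      qed simp
    qed simp
    ultimately show ?case by simp
  qed
  moreover have "card {x \<in> X. f x = j} = card {y \<in> Y. g y = j}" if "\<not> j \<le> r"
  proof -
    have "{x \<in> X. f x = j} = {}" "{y \<in> Y. g y = j} = {}" using assms(3,4) that by auto
    then show ?thesis by (simp only: card.empty)
  qed
  ultimately show ?thesis by blast
qed

section \<open>Neighbourhoods of copies of a component\<close>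

context simple_adj
begin

lemma nbhd_singleton: "nbhd E V {v} = {u \<in> V. E v u}"
  using adj_irrefl by (auto simp: nbhd_def)

lemma card_nbhd_singleton: "card (nbhd E V {v}) = adj_card E {v} V"
  by (simp add: nbhd_singleton adj_card_singleton)

lemma connected_in_insert:
  assumes S: "connected_in E S" and u: "u \<in> S" "E u v" and v: "v \<notin> S"
  shows "connected_in E (insert v S)"
  unfolding connected_in_def
proof (intro conjI allI impI)
  fix A assume A: "A \<subseteq> insert v S" "A \<noteq> {}" "A \<noteq> insert v S"
  show "\<exists>a\<in>A. \<exists>b\<in>insert v S - A. E a b"
  proof (cases "u \<in> A \<longleftrightarrow> v \<in> A")
    case False
    then show ?thesis using u adj_sym by blast
  next
    case True
    let ?A = "A - {v}"
    have "?A \<subseteq> S" "?A \<noteq> {}" "?A \<noteq> S" using A True u v by auto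
    then obtain a b where "a \<in> ?A" "b \<in> S - ?A" "E a b"
      using S unfolding connected_in_def by meson
    then show ?thesis using v by blast
  qed
qed simp

text \<open>Enlarge \<open>S\<close> to a largest connected \<open>X\<close> with no fewer
  neighbours. Each neighbour \<open>v\<close> of \<open>X\<close> is then a leaf: if it had a
  further neighbour \<open>w\<close>, moving \<open>v\<close> into \<open>X\<close> would lose
  \<open>v\<close> but gain \<open>w\<close>.\<close>

lemma forest_leaves:
  assumes fin: "finite V"
    and sparse: "\<And>W. W \<subseteq> V \<Longrightarrow> W \<noteq> {} \<Longrightarrow> adj_card E W W < 2 * card W"
    and S: "S \<subseteq> V" "connected_in E S"
  shows "card (nbhd E V S) \<le> card {v \<in> V. card (nbhd E V {v}) = 1}"
proof -
  define P where "P X \<longleftrightarrow> X \<subseteq> V \<and> connected_in E X \<and> card (nbhd E V S) \<le> card (nbhd E V X)" for X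
  have "P S" using S by (simp add: P_def)
  moreover have "\<forall>X. P X \<longrightarrow> card X < Suc (card V)"
    using fin by (auto simp: P_def less_Suc_eq_le intro: card_mono)
  ultimately have "\<exists>X. P X \<and> (\<forall>Y. P Y \<longrightarrow> card Y \<le> card X)"
    by (rule ex_has_greatest_nat)
  then obtain X where X: "P X" and max: "\<And>Y. P Y \<Longrightarrow> card Y \<le> card X" by blast
  have XV: "X \<subseteq> V" and con: "connected_in E X" and fX: "finite X"
    using X finite_subset[OF _ fin] by (simp_all add: P_def)
  have "nbhd E V X \<subseteq> {v \<in> V. card (nbhd E V {v}) = 1}"
  proof
    fix v assume v: "v \<in> nbhd E V X"
    then obtain u where u: "u \<in> X" "E u v" "v \<notin> X" "v \<in> V" by (auto simp: nbhd_def)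
    let ?Y = "insert v X"
    have conY: "connected_in E ?Y" by (rule connected_in_insert[OF con u(1-3)])
    have fY: "finite ?Y" and cY: "card ?Y = Suc (card X)" using fX u by auto
    have vX: "adj_card E {v} X \<le> 1"
      using sparse[of ?Y] u XV adj_card_insert[OF fX u(3)] connected_in_adj_card[OF fX con] cY by simp
    have "card (nbhd E V {v}) \<ge> 1"
      using u XV adj_sym fin by (auto simp: nbhd_singleton Suc_le_eq card_gt_0_iff)
    moreover have "\<not> card (nbhd E V {v}) \<ge> 2"
    proof
      assume "2 \<le> card (nbhd E V {v})"
      moreover have "adj_card E {v} V = adj_card E {v} X + adj_card E {v} (V - X)"
        using adj_card_Un_right[of X "V - X" "{v}"] fX fin XV by (simp add: Un_absorb1)
      ultimately have "adj_card E {v} (V - X) \<noteq> 0" using vX by (simp add: card_nbhd_singleton)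
      then obtain w where w: "w \<in> V" "w \<notin> X" "E v w"
        using adj_card_eq_0_iff[of "{v}" "V - X" E] fin by auto
      have wY: "w \<notin> ?Y" using w adj_irrefl by auto
      \<comment> \<open>A vertex \<open>w\<close> adjacent to both \<open>v\<close> and
        \<open>X\<close> would close a cycle: \<open>insert w ?Y\<close> would have as many edges as
        vertices.\<close>
      have wN: "w \<notin> nbhd E V X"
      proof
        assume "w \<in> nbhd E V X"
        then obtain x where x: "x \<in> X" "E x w" by (auto simp: nbhd_def)
        have "{v, x} \<subseteq> {b \<in> ?Y. E w b}" using x w adj_sym by auto
        then have "card {v, x} \<le> adj_card E {w} ?Y"
          unfolding adj_card_singleton using fY by (intro card_mono) auto
        moreover have "v \<noteq> x" using x(1) u(3) by auto
        ultimately have "2 \<le> adj_card E {w} ?Y" by simp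
        moreover have "card (insert w ?Y) = Suc (Suc (card X))" using fY wY cY by simp
        ultimately show False
          using sparse[of "insert w ?Y"] adj_card_insert[OF fY wY] connected_in_adj_card[OF fY conY]
            cY w u XV by simp
      qed
      have "insert w (nbhd E V X - {v}) \<subseteq> nbhd E V ?Y"
        using w wY by (auto simp: nbhd_def)
      then have "card (insert w (nbhd E V X - {v})) \<le> card (nbhd E V ?Y)"
        using fin by (intro card_mono) auto
      moreover have "card (insert w (nbhd E V X - {v})) = Suc (card (nbhd E V X - {v}))"
        using wN fin by simp
      moreover have "Suc (card (nbhd E V X - {v})) = card (nbhd E V X)"
        using card.remove[OF finite_nbhd[OF fin] v] by (rule sym)
      ultimately have "card (nbhd E V X) \<le> card (nbhd E V ?Y)" by linarith
      then have "P ?Y" using X conY XV u by (auto simp: P_def)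
      from max[OF this] show False using cY by simp
    qed
    ultimately show "v \<in> {v \<in> V. card (nbhd E V {v}) = 1}" using u(4) by simp
  qed
  then have "card (nbhd E V X) \<le> card {v \<in> V. card (nbhd E V {v}) = 1}"
    using fin by (intro card_mono) auto
  then show ?thesis using X by (simp add: P_def)
qed

text \<open>Distinct components are disjoint and have no edges to each other or to the rest, so both
  counts split.\<close>

lemma closed_family_sums:
  assumes "finite V" "finite \<T>"
    and "\<And>T. T \<in> \<T> \<Longrightarrow> T \<subseteq> V \<and> connected_in E T \<and> nbhd E V T = {}"
  shows "adj_card E V V = (\<Sum>T\<in>\<T>. adj_card E T T) + adj_card E (V - \<Union>\<T>) (V - \<Union>\<T>)
    \<and> card V = (\<Sum>T\<in>\<T>. card T) + card (V - \<Union>\<T>)"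
  using assms(2,3)
proof (induction \<T> rule: finite_induct)
  case (insert T F)
  let ?V = "V - \<Union>F"
  have T: "T \<subseteq> V" "connected_in E T" "nbhd E V T = {}" using insert.prems by auto
  have "T \<inter> T' = {}" if "T' \<in> F" for T'
    using connected_closed_eq[of T V T'] insert.prems insert.hyps(2) that by blast
  then have TV: "T \<subseteq> ?V" using T(1) by auto
  have "nbhd E ?V T = {}" using T(3) by (auto simp: nbhd_def)
  then have "adj_card E ?V ?V = adj_card E T T + adj_card E (?V - T) (?V - T)"
    using adj_card_closed_split[of ?V T] TV assms(1) by simp
  moreover have "card ?V = card T + card (?V - T)"
    using TV assms(1) by (metis card_Diff_subset card_mono finite_Diff finite_subset le_add_diff_inverse)
  moreover have "?V - T = V - \<Union>(insert T F)" by auto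
  ultimately show ?case using insert by simp
qed simp

end

lemma copies_singleton:
  assumes "\<And>v. \<not> E v v" "\<And>v. \<not> E' v v"
  shows "copies E V E' {w} = (\<lambda>v. {v}) ` V"
proof -
  have "\<exists>v\<in>V. S = {v}" if "S \<in> copies E V E' {w}" for S
    using that induced_iso_card[of E S E' "{w}"] by (auto simp: copies_def card_1_singleton_iff)
  moreover have "induced_iso E {v} E' {w}" for v
    unfolding induced_iso_def using assms by (intro exI[of _ "\<lambda>_. w"]) (auto simp: bij_betw_def)
  ultimately show ?thesis by (auto simp: copies_def)
qed

lemma sum_copies_singleton:
  assumes "\<And>v. \<not> E v v" "\<And>v. \<not> E' v v"
  shows "(\<Sum>S\<in>copies E V E' {w}. h S) = (\<Sum>v\<in>V. h {v})"
  by (simp add: copies_singleton[of E E', OF assms] sum.reindex)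

text \<open>Both families are grouped by isomorphism type; the weights are constant on each type and
  the types occur equally often.\<close>

lemma sum_iso_classes:
  assumes fin: "finite \<S>" "finite \<T>"
    and cover: "\<And>S. S \<in> \<S> \<Longrightarrow> \<exists>T\<in>\<T>. induced_iso E S E' T"
    and count: "\<And>T. T \<in> \<T> \<Longrightarrow>
      card {S \<in> \<S>. induced_iso E S E' T} = card {S \<in> \<T>. induced_iso E' S E' T}"
    and w: "\<And>S T. induced_iso E S E' T \<Longrightarrow> w S = w' T"
    and w': "\<And>S T. induced_iso E' S E' T \<Longrightarrow> w' S = w' T"
  shows "(\<Sum>S\<in>\<S>. w S) = (\<Sum>T\<in>\<T>. (w' T :: nat))"
proof -
  \<comment> \<open>A type is labelled by the set of members of \<open>\<T>\<close> that have it, so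
    that families over different vertex types share their labels.\<close>
  define \<kappa> where "\<kappa> S = {T \<in> \<T>. induced_iso E S E' T}" for S
  define \<kappa>' where "\<kappa>' S = {T \<in> \<T>. induced_iso E' S E' T}" for S
  have \<kappa>_eq: "\<kappa> S = \<kappa>' T" if "induced_iso E S E' T" for S T
    unfolding \<kappa>_def \<kappa>'_def
    using that induced_iso_trans[OF that] induced_iso_trans[OF induced_iso_sym[OF that]] by blast
  have \<kappa>'_eq: "\<kappa>' S = \<kappa>' T" if "induced_iso E' S E' T" for S T
    unfolding \<kappa>'_def
    using that induced_iso_trans[OF that] induced_iso_trans[OF induced_iso_sym[OF that]] by blast
  have self: "T \<in> \<kappa>' T" if "T \<in> \<T>" for T
    using that induced_iso_refl by (auto simp: \<kappa>'_def)
  have "(\<Sum>S\<in>\<S>. w S) = (\<Sum>c\<in>\<kappa>' ` \<T>. \<Sum>S | S \<in> \<S> \<and> \<kappa> S = c. w S)"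
    by (intro sum.group[symmetric]) (use fin cover \<kappa>_eq in blast)+
  also have "\<dots> = (\<Sum>c\<in>\<kappa>' ` \<T>. \<Sum>T | T \<in> \<T> \<and> \<kappa>' T = c. w' T)"
  proof (rule sum.cong)
    fix c assume "c \<in> \<kappa>' ` \<T>"
    then obtain T where T: "T \<in> \<T>" and c: "c = \<kappa>' T" by auto
    have S: "{S \<in> \<S>. \<kappa> S = c} = {S \<in> \<S>. induced_iso E S E' T}"
      using self[OF T] \<kappa>_eq unfolding c by (auto simp: \<kappa>_def)
    have T': "{S \<in> \<T>. \<kappa>' S = c} = {S \<in> \<T>. induced_iso E' S E' T}"
      using self[OF T] \<kappa>'_eq unfolding c by (auto simp: \<kappa>'_def)
    have "(\<Sum>S | S \<in> \<S> \<and> \<kappa> S = c. w S) = (\<Sum>S | S \<in> \<S> \<and> induced_iso E S E' T. w' T)"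
      unfolding S by (rule sum.cong) (use w in auto)
    moreover have "(\<Sum>S | S \<in> \<T> \<and> \<kappa>' S = c. w' S) = (\<Sum>S | S \<in> \<T> \<and> induced_iso E' S E' T. w' T)"
      unfolding T' by (rule sum.cong) (use w' in auto)
    ultimately show "(\<Sum>S | S \<in> \<S> \<and> \<kappa> S = c. w S) = (\<Sum>S | S \<in> \<T> \<and> \<kappa>' S = c. w' S)"
      using count[OF T] by simp
  qed simp
  also have "\<dots> = (\<Sum>T\<in>\<T>. w' T)"
    by (intro sum.group) (use fin in auto)
  finally show ?thesis .
qed

context shortest_cycle
begin

section \<open>A component avoiding the shortest cycle\<close>

context
  fixes T k
  assumes T: "T \<subseteq> V" "connected_in E T" "nbhd E V T = {}" "T \<inter> C = {}"
    and k: "card V + 1 \<le> 2 * k" "k < card C"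
begin

lemma card_outside: "card (V - C - T) + card C + card T = card V"
proof -
  have "card (V - C - T) = card (V - C) - card T"
    using T finite_sub by (intro card_Diff_subset) auto
  moreover have "card T \<le> card (V - C)" using T fin by (intro card_mono) auto
  moreover have "card (V - C) = card V - card C" "card C \<le> card V"
    using C_subset finite_C fin by (auto intro: card_Diff_subset card_mono)
  ultimately show ?thesis by linarith
qed

text \<open>Off the cycle, \<open>S\<close> and its neighbourhood are disjoint parts of
  \<open>V - C - T\<close>; on the cycle \<open>S\<close> has at most two neighbours. With
  \<open>card V < 2 * k\<close> and \<open>k < card C\<close> the total is at most \<open>k\<close>,
  and equality makes every estimate tight.\<close>

lemma card_add_nbhd_le:
  assumes S: "S \<subseteq> V" "connected_in E S" "S \<inter> T = {}" "card S \<le> card T"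
  shows "card S + card (nbhd E V S) \<le> card (S \<inter> C) + 2 + card (V - C - T)"
    and "card S + card (nbhd E V S) \<le> k"
    and "card S + card (nbhd E V S) = k \<Longrightarrow> S \<subseteq> C \<and> card V + 1 = 2 * k \<and> card C = Suc k
      \<and> V - C - T \<subseteq> nbhd E V S"
proof -
  let ?N = "nbhd E V S" and ?Q = "V - C - T"
  have fS: "finite S" and fN: "finite ?N" and fQ: "finite ?Q" using S fin finite_sub by auto
  have NT: "?N \<inter> T = {}" using T(3) S(1,3) adj_sym by (force simp: nbhd_def)
  have dis: "(S - C) \<inter> (?N - C) = {}" by (auto simp: nbhd_def)
  have sub: "(S - C) \<union> (?N - C) \<subseteq> ?Q" using S NT by (auto simp: nbhd_def)
  have out: "card (S - C) + card (?N - C) \<le> card ?Q"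
    using card_mono[OF fQ sub] card_Un_disjoint[OF _ _ dis] fS fN by simp
  \<comment> \<open>\<open>S - C\<close> has at most \<open>card T\<close> and at most
    \<open>card (V - C - T)\<close> vertices. These numbers add up to
    \<open>card V - card C \<le> k - 2\<close>, so \<open>S - C\<close> is small enough for
    \<open>nbhd_on_cycle\<close>.\<close>
  have "card (S - C) \<le> card T" using S(4) card_mono[of S "S - C"] fS by auto
  then have small: "2 * card (S - C) + 3 \<le> card C" "card S < card C"
    using card_outside out k S(4) by linarith+
  have onC: "card (?N \<inter> C) \<le> (if S \<inter> C = {} then 1 else 2)"
    using nbhd_on_cycle[OF S(1,2) small(2,1)] .
  have split: "card S = card (S \<inter> C) + card (S - C)" "card ?N = card (?N \<inter> C) + card (?N - C)"
    using card_Int_Diff[of S C] card_Int_Diff[of ?N C] fS fN by (simp_all add: add.commute)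
  show le: "card S + card ?N \<le> card (S \<inter> C) + 2 + card ?Q"
    using onC split out by (auto split: if_splits)
  have SC: "card (S \<inter> C) \<le> card S" using fS by (intro card_mono) auto
  then show "card S + card ?N \<le> k"
    using le card_outside k S(4) by linarith
  assume eq: "card S + card ?N = k"
  have "card (S \<inter> C) = card S" "card V + 1 = 2 * k" "card C = Suc k" "card (?N \<inter> C) \<le> 2"
    using le card_outside k S(4) SC eq onC by (auto split: if_splits)
  moreover from this have "S \<inter> C = S" using fS by (intro card_subset_eq) auto
  moreover have "?N - C = ?Q"
  proof (rule card_subset_eq[OF fQ])
    show "card (?N - C) = card ?Q"
      using calculation split out eq card_outside k S(4) by linarith
  qed (use sub in auto)
  ultimately show "S \<subseteq> C \<and> card V + 1 = 2 * k \<and> card C = Suc k \<and> ?Q \<subseteq> ?N" by auto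
qed

lemma card_T_less: "card T + 2 \<le> k"
  using card_outside k by linarith

text \<open>A connected set of this size that meets \<open>T\<close> equals \<open>T\<close> and has
  no neighbours; all others fall under \<open>card_add_nbhd_le\<close>.\<close>

lemma closed_copy_bound:
  assumes S: "S \<subseteq> V" "connected_in E S" "card S = card T"
  shows "card S + card (nbhd E V S) \<le> k"
    and "card S + card (nbhd E V S) = k \<Longrightarrow> S \<subseteq> C \<and> card V + 1 = 2 * k \<and> card C = Suc k
      \<and> V - C - T \<subseteq> nbhd E V S"
proof -
  have "card S + card (nbhd E V S) < k" if "S \<inter> T \<noteq> {}"
  proof -
    have "S \<subseteq> T" using connected_in_subset_closed[OF S(2,1) T(3) that] .
    then have "S = T" using S(3) T finite_sub by (intro card_subset_eq) auto
    then show ?thesis using T(3) card_T_less by simp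
  qed
  then show "card S + card (nbhd E V S) \<le> k"
    and "card S + card (nbhd E V S) = k \<Longrightarrow> S \<subseteq> C \<and> card V + 1 = 2 * k \<and> card C = Suc k
      \<and> V - C - T \<subseteq> nbhd E V S"
    using card_add_nbhd_le[OF S(1,2)] S(3) by fastforce+
qed

text \<open>For \<open>v\<close> outside \<open>T\<close> the extra slack comes from
  \<open>card {v} < card T\<close>. It makes the degree moment of order \<open>k - 1\<close>
  vanish.\<close>

lemma degree_bound:
  assumes "2 \<le> card T" "v \<in> V"
  shows "card (nbhd E V {v}) + 2 \<le> k"
proof (cases "v \<in> T")
  case True
  have "nbhd E V {v} \<subseteq> T - {v}" using T(3) True by (auto simp: nbhd_def)
  then have "card (nbhd E V {v}) \<le> card T"
    using T finite_sub by (intro card_mono) auto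
  then show ?thesis using card_T_less by simp
next
  case False
  have "card ({v} \<inter> C) \<le> card {v}" by (intro card_mono) auto
  then show ?thesis
    using card_add_nbhd_le(1)[of "{v}"] False assms card_outside k by simp
qed

text \<open>Vertices of \<open>C\<close> are not leaves. Leaves in \<open>T\<close> correspond to
  leaves of its copy \<open>S\<close>, which lies on the cycle and is connected, so there are at
  most two.\<close>

lemma leaves_bound:
  assumes S: "S \<subseteq> C" "connected_in E S" "induced_iso E T E S"
  shows "card {v \<in> V. card (nbhd E V {v}) = 1} \<le> card (V - C - T) + 2"
proof -
  have fT: "finite T" and fS: "finite S" using T S C_subset finite_sub by auto
  let ?L = "{v \<in> T. adj_card E {v} T = 1}"
  have leafT: "adj_card E {v} V = adj_card E {v} T" if "v \<in> T" for v
  proof -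
    have "{b \<in> V. E v b} = {b \<in> T. E v b}" using T(1,3) that by (auto simp: nbhd_def)
    then show ?thesis by (simp add: adj_card_singleton)
  qed
  have "adj_card E {v} V \<ge> 2" if "v \<in> C" for v
    using adj_card_mono[of "{v}" V "{v}" C E] fin C_subset deg_eq_2[OF that] by simp
  then have "{v \<in> V. card (nbhd E V {v}) = 1} \<subseteq> (V - C - T) \<union> ?L"
    using leafT by (fastforce simp: card_nbhd_singleton)
  then have "card {v \<in> V. card (nbhd E V {v}) = 1} \<le> card ((V - C - T) \<union> ?L)"
    using fin fT by (intro card_mono) auto
  also have "\<dots> \<le> card (V - C - T) + card ?L" by (rule card_Un_le)
  also have "card ?L = card {v \<in> S. adj_card E {v} S = 1}"
    by (rule induced_iso_card_degree[OF S(3)])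
  also have "\<dots> \<le> 2"
  proof -
    have "adj_card E {v} S \<le> 2" if "v \<in> S" for v
      using adj_card_mono[of "{v}" C "{v}" S E] S finite_C deg_eq_2[of v] that by auto
    \<comment> \<open>Degree plus one for each leaf is at most 2 per vertex, while the degrees sum
      to at least \<open>2 * card S - 2\<close>; hence at most two leaves.\<close>
    then have "(\<Sum>v\<in>S. adj_card E {v} S + of_bool (adj_card E {v} S = 1)) \<le> (\<Sum>v\<in>S. 2)"
      by (intro sum_mono) (fastforce simp: le_Suc_eq numeral_2_eq_2)
    also have "(\<Sum>v\<in>S. adj_card E {v} S + of_bool (adj_card E {v} S = 1)) =
        adj_card E S S + card {v \<in> S. adj_card E {v} S = 1}"
      using fS adj_card_sum[OF fS fS, of E] by (simp add: sum.distrib of_bool_def sum.If_cases Int_def)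
    finally show ?thesis using connected_in_adj_card[OF fS S(2)] by simp
  qed
  finally show ?thesis by simp
qed

end

end

section \<open>Comparing a forest with a graph containing a cycle\<close>

text \<open>The situation to be refuted: a forest on \<open>V\<close> and a graph with a cycle on
  \<open>V'\<close>. The deck enters only through \<open>moments\<close>.\<close>

locale same_moments =
  F: simple_adj E + H: shortest_cycle E' V' C
  for E :: "'a \<Rightarrow> 'a \<Rightarrow> bool" and E' :: "'b \<Rightarrow> 'b \<Rightarrow> bool" and V' C +
  fixes V k
  assumes finV: "finite V"
    and card_eq: "card V = card V'" and k: "card V + 1 \<le> 2 * k" and not_5_3: "(card V, k) \<noteq> (5, 3)"
    and moments: "\<And>T i. T \<subseteq> V' \<Longrightarrow> card T + i \<le> k \<Longrightarrow>
      (\<Sum>S\<in>copies E V E' T. card (nbhd E V S) choose i) =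
      (\<Sum>S\<in>copies E' V' E' T. card (nbhd E' V' S) choose i)"
    and forest: "\<And>W. W \<subseteq> V \<Longrightarrow> W \<noteq> {} \<Longrightarrow> adj_card E W W < 2 * card W"
begin

text \<open>Otherwise the moment of order 0 counts the copies of \<open>C\<close>, and the forest
  would contain one.\<close>

lemma k_less: "k < card C"
proof (rule ccontr)
  assume "\<not> k < card C"
  then have "card (copies E V E' C) = card (copies E' V' E' C)"
    using moments[of C 0] H.C_subset by simp
  moreover have "C \<in> copies E' V' E' C"
    using H.C_subset induced_iso_refl by (auto simp: copies_def)
  ultimately have "copies E V E' C \<noteq> {}"
    using finite_copies[OF H.fin, of E' E' C] by (metis card.empty card_0_eq empty_iff)
  then obtain S where S: "S \<subseteq> V" "induced_iso E S E' C" by (auto simp: copies_def)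
  have "card S > 0"
    using induced_iso_card[OF S(2)] H.C_nonempty H.finite_C by (simp add: card_gt_0_iff)
  then have "S \<noteq> {}" by auto
  then show False
    using forest[OF S(1)] induced_iso_card[OF S(2)] induced_iso_adj_card[OF S(2)] H.C_dense by simp
qed

lemma k_ge_2: "k \<ge> 2"
  using k k_less card_mono[OF H.fin H.C_subset] card_eq by linarith

text \<open>For a single vertex as \<open>T\<close>, the neighbourhood sizes of the copies are the
  vertex degrees.\<close>

lemma degree_moments:
  assumes "i < k"
  shows "(\<Sum>v\<in>V. card (nbhd E V {v}) choose i) = (\<Sum>v\<in>V'. card (nbhd E' V' {v}) choose i)"
proof -
  obtain w where w: "w \<in> V'" using H.C_nonempty H.C_subset by auto
  show ?thesis
    using moments[of "{w}" i] w assms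
    by (simp add: sum_copies_singleton[of E E', OF F.adj_irrefl H.adj_irrefl]
        sum_copies_singleton[of E' E', OF H.adj_irrefl H.adj_irrefl])
qed

lemma adj_card_eq: "adj_card E V V = adj_card E' V' V'"
  using degree_moments[of 1] k_ge_2 finV H.fin
  by (simp add: F.card_nbhd_singleton H.card_nbhd_singleton adj_card_sum[of V V E] adj_card_sum[of V' V' E'])

section \<open>Copies of a component of the graph with a cycle, in both graphs\<close>

context
  fixes T
  assumes T: "T \<subseteq> V'" "connected_in E' T" "nbhd E' V' T = {}" "T \<inter> C = {}"
begin

lemmas T' = T k[unfolded card_eq] k_less

lemma copy_cases:
  assumes "S \<in> copies E' V' E' T"
  shows "S \<subseteq> V'" "connected_in E' S" "card S = card T"
  using assms induced_iso_card induced_iso_connected_in[OF induced_iso_sym T(2)]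
  by (auto simp: copies_def)

lemma no_large_nbhd:
  assumes S0: "S0 \<in> copies E V E' T"
  shows "card S0 + card (nbhd E V S0) \<le> k"
proof (rule ccontr)
  assume "\<not> ?thesis"
  then have large: "k < card S0 + card (nbhd E V S0)" by simp
  have S0V: "S0 \<subseteq> V" and iso: "induced_iso E S0 E' T" using S0 by (auto simp: copies_def)
  have cS0: "card S0 = card T" using induced_iso_card[OF iso] .
  have conS0: "connected_in E S0" using induced_iso_connected_in[OF induced_iso_sym[OF iso] T(2)] .
  have tk: "card T + 2 \<le> k" by (rule H.card_T_less[OF T'])
  define r where "r = k - card T"
  \<comment> \<open>The order \<open>r\<close> is the largest that \<open>moments\<close> provides
    for \<open>T\<close>. By \<open>S0\<close> this moment is positive, so some copy
    \<open>S\<close> in \<open>V'\<close> has at least \<open>r\<close> neighbours, which is the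
    extremal number.\<close>
  have "0 < (\<Sum>S\<in>copies E V E' T. card (nbhd E V S) choose r)"
    using S0 large cS0 finite_copies[OF finV, of E E' T]
    by (intro sum_pos2[of _ S0]) (auto simp: r_def)
  then have "0 < (\<Sum>S\<in>copies E' V' E' T. card (nbhd E' V' S) choose r)"
    using moments[of T r] T(1) tk by (simp add: r_def)
  then obtain S where S: "S \<in> copies E' V' E' T" "0 < card (nbhd E' V' S) choose r"
    by (metis (no_types, lifting) neq0_conv sum.neutral)
  note Sc = copy_cases[OF S(1)]
  have "card S + card (nbhd E' V' S) = k"
    using H.closed_copy_bound(1)[OF T' Sc] S(2) Sc(3) tk
    by (simp add: r_def zero_less_binomial_iff)
  note extremal = H.closed_copy_bound(2)[OF T' Sc this]
  \<comment> \<open>Tightness gives \<open>card V' = 2 * k - 1\<close> and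
    \<open>card C = k + 1\<close>, which fixes the number of remaining vertices.\<close>
  have out: "card (V' - C - T) + 2 = r"
  proof -
    have "card V' + 1 = 2 * k" "card C = Suc k" using extremal by simp_all
    then show ?thesis using H.card_outside[OF T'] tk unfolding r_def by linarith
  qed
  show False
  proof (cases "2 \<le> card T")
    case True
    have boundH: "card (nbhd E' V' {v}) + 2 \<le> k" if "v \<in> V'" for v
      using H.degree_bound[OF T' True that] .
    \<comment> \<open>The vanishing moment also caps the degrees in \<open>V\<close>. Hence the
      degree moments of orders below \<open>k\<close> determine the degree sequence, in particular
      the number of leaves.\<close>
    then have "(\<Sum>v\<in>V'. card (nbhd E' V' {v}) choose (k - 1)) = 0"
      by (intro sum.neutral) (fastforce intro: binomial_eq_0)
    then have "(\<Sum>v\<in>V. card (nbhd E V {v}) choose (k - 1)) = 0"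
      using degree_moments[of "k - 1"] k_ge_2 by simp
    then have boundF: "card (nbhd E V {v}) \<le> k - 1" if "v \<in> V" for v
      using that finV by (auto simp: binomial_eq_0_iff)
    have "card {v \<in> V. card (nbhd E V {v}) = 1} = card {v \<in> V'. card (nbhd E' V' {v}) = 1}"
    proof (rule card_fibres_eq[OF finV H.fin, where r = "k - 1"])
      show "card (nbhd E' V' {v}) \<le> k - 1" if "v \<in> V'" for v using boundH[OF that] by simp
    qed (use boundF degree_moments k_ge_2 in auto)
    moreover have "induced_iso E' T E' S"
      using S(1) induced_iso_sym by (auto simp: copies_def)
    then have "card {v \<in> V'. card (nbhd E' V' {v}) = 1} \<le> r"
      using H.leaves_bound[OF T', of S] extremal Sc out by simp
    \<comment> \<open>\<open>S0\<close> has more than \<open>r\<close> neighbours, so the forest has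
      more than \<open>r\<close> leaves, against the bound \<open>r\<close> in
      \<open>V'\<close>.\<close>
    moreover have "card (nbhd E V S0) \<le> card {v \<in> V. card (nbhd E V {v}) = 1}"
      using F.forest_leaves[OF finV forest S0V conS0] .
    ultimately show False using large cS0 tk unfolding r_def by linarith
  next
    case False
    have "card T \<noteq> 0" using T(2) H.finite_sub[OF T(1)] by (auto simp: connected_in_def)
    then have t1: "card T = 1" using False by simp
    then obtain v0 where v0: "S0 = {v0}" using cS0 by (auto simp: card_1_singleton_iff)
    have single: "card (nbhd E' V' {v}) + 1 \<le> k"
        "card (nbhd E' V' {v}) + 1 = k \<Longrightarrow> v \<in> C \<and> V' - C - T \<subseteq> nbhd E' V' {v}" if "v \<in> V'" for v
      using H.closed_copy_bound[OF T', of "{v}"] that t1 by auto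
    let ?X = "{v \<in> V'. card (nbhd E' V' {v}) = k - 1}"
    \<comment> \<open>\<open>v0\<close> has degree at least \<open>k\<close> and contributes at
      least \<open>k\<close> to the moment of order \<open>k - 1\<close>. Degrees in
      \<open>V'\<close> are at most \<open>k - 1\<close>, so there this moment is the number of
      vertices of degree \<open>k - 1\<close>.\<close>
    have "k = k choose (k - 1)"
      using binomial_symmetric[of 1 k] k_ge_2 by simp
    also have "\<dots> \<le> card (nbhd E V {v0}) choose (k - 1)"
      using large cS0 v0 by (intro binomial_right_mono) simp
    also have "\<dots> \<le> (\<Sum>v\<in>V. card (nbhd E V {v}) choose (k - 1))"
      using S0V v0 finV by (intro member_le_sum) auto
    also have "\<dots> = (\<Sum>v\<in>V'. card (nbhd E' V' {v}) choose (k - 1))"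
      using degree_moments[of "k - 1"] k_ge_2 by simp
    also have "\<dots> = (\<Sum>v\<in>V'. of_bool (card (nbhd E' V' {v}) = k - 1))"
      using single(1) by (intro sum.cong) (force simp: binomial_eq_0)+
    also have "\<dots> = card ?X" using H.fin by (simp add: of_bool_def sum.If_cases Int_def)
    finally have "2 \<le> card ?X" using k_ge_2 by simp
    then obtain s s' where s: "s \<in> ?X" "s' \<in> ?X" "s \<noteq> s'"
      using card_le_Suc0_iff_eq[of ?X] H.fin by (auto simp: not_less_eq_eq[symmetric] numeral_2_eq_2)
    have C: "s \<in> C" "s' \<in> C" and Q: "V' - C - T \<subseteq> nbhd E' V' {s} \<inter> nbhd E' V' {s'}"
      using single(2) s k_ge_2 by auto
    show False
    proof (cases "V' - C - T = {}")
      case True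
      then have "card (V' - C - T) = 0" by (simp only: card.empty)
      \<comment> \<open>Here \<open>r = 2\<close>, so \<open>k = 3\<close> and
        \<open>card V = 5\<close>: the excluded pair.\<close>
      then have "k = 3" using out t1 unfolding r_def by linarith
      then show False using extremal card_eq not_5_3 by simp
    next
      case False
      then obtain u where u: "u \<in> V' - C - T" by auto
      then have "E' s u" "E' s' u" using Q by (auto simp: nbhd_def)
      then have "{s, s'} \<subseteq> {b \<in> C. E' u b}" using C H.adj_sym by auto
      then have "card {s, s'} \<le> adj_card E' {u} C"
        unfolding adj_card_singleton using H.finite_C by (intro card_mono) auto
      moreover have "card (V' - C - T) > 0" using False H.fin by (simp add: card_gt_0_iff)
      \<comment> \<open>\<open>u\<close> is joined to the cycle twice, against
        \<open>small_attached\<close> for \<open>{u}\<close>, which requires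
        \<open>card C \<ge> 5\<close>.\<close>
      then have "5 \<le> card C" using out extremal t1 by (simp add: r_def)
      ultimately show False using H.small_attached[of "{u}"] u s(3) by simp
    qed
  qed
qed

lemma card_closed_copies:
  "card {S \<in> copies E V E' T. nbhd E V S = {}} = card {S \<in> copies E' V' E' T. nbhd E' V' S = {}}"
proof -
  have tk: "card T + 2 \<le> k" by (rule H.card_T_less[OF T'])
  have "card {S \<in> copies E V E' T. card (nbhd E V S) = 0} =
      card {S \<in> copies E' V' E' T. card (nbhd E' V' S) = 0}"
  proof (rule card_fibres_eq[where r = "k - card T"])
    show "card (nbhd E V S) \<le> k - card T" if "S \<in> copies E V E' T" for S
      using no_large_nbhd[OF that] that induced_iso_card[of E S E' T] by (simp add: copies_def)
    show "card (nbhd E' V' S) \<le> k - card T" if "S \<in> copies E' V' E' T" for S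
      using H.closed_copy_bound(1)[OF T' copy_cases[OF that]] copy_cases(3)[OF that] by simp
    show "(\<Sum>S\<in>copies E V E' T. card (nbhd E V S) choose i) =
        (\<Sum>S\<in>copies E' V' E' T. card (nbhd E' V' S) choose i)" if "i \<le> k - card T" for i
      using moments[of T i] T(1) tk that by simp
  qed (simp_all add: finite_copies finV H.fin)
  then show ?thesis using finV H.fin by simp
qed

text \<open>A closed set keeps both cycle edges at each of its vertices on \<open>C\<close>. Being
  too small to contain \<open>C\<close>, it would cut out a proper part of \<open>C\<close> with as
  many edges as vertices.\<close>

lemma closed_copy_avoids_cycle:
  assumes "S \<in> copies E' V' E' T" "nbhd E' V' S = {}"
  shows "S \<inter> C = {}"
proof (rule ccontr)
  assume ne: "S \<inter> C \<noteq> {}"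
  note Sc = copy_cases[OF assms(1)]
  have fS: "finite S" using Sc H.finite_sub by simp
  have "card S < card C" using Sc(3) H.card_T_less[OF T'] k_less by simp
  then have "S \<inter> C \<noteq> C" using fS by (metis Int_lower1 card_mono linorder_not_le)
  then have "adj_card E' (S \<inter> C) (S \<inter> C) + 2 \<le> 2 * card (S \<inter> C)"
    using H.proper_sparse[of "S \<inter> C"] ne by auto
  moreover have "2 * card (S \<inter> C) = adj_card E' (S \<inter> C) C"
    using H.adj_card_subset_C[of "S \<inter> C"] by simp
  moreover have "{(a, b). a \<in> S \<inter> C \<and> b \<in> C \<and> E' a b} = {(a, b). a \<in> S \<inter> C \<and> b \<in> S \<inter> C \<and> E' a b}"
    using assms(2) H.C_subset by (auto simp: nbhd_def)
  then have "adj_card E' (S \<inter> C) C = adj_card E' (S \<inter> C) (S \<inter> C)"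
    by (simp add: adj_card_def)
  ultimately show False by simp
qed

end

lemma contradiction: False
proof -
  define \<T> where "\<T> = {T. T \<subseteq> V' \<and> connected_in E' T \<and> nbhd E' V' T = {} \<and> T \<inter> C = {}}"
  define \<S> where "\<S> = {S. S \<subseteq> V \<and> nbhd E V S = {} \<and> (\<exists>T\<in>\<T>. induced_iso E S E' T)}"
  \<comment> \<open>\<open>B\<close> is what remains of the graph with a cycle once all components
    avoiding \<open>C\<close> are deleted, and \<open>R\<close> is what remains of the forest once
    their isomorphic counterparts are.\<close>
  define B where "B = V' - \<Union>\<T>"
  define R where "R = V - \<Union>\<S>"
  have fin: "finite \<T>" "finite \<S>"
    unfolding \<T>_def \<S>_def
    by (rule finite_subset[of _ "Pow V'"], use H.fin in auto) (rule finite_subset[of _ "Pow V"], use finV in auto)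
  have count: "card {S \<in> \<S>. induced_iso E S E' T} = card {S \<in> \<T>. induced_iso E' S E' T}"
    if "T \<in> \<T>" for T
  proof -
    have T: "T \<subseteq> V'" "connected_in E' T" "nbhd E' V' T = {}" "T \<inter> C = {}"
      using that by (auto simp: \<T>_def)
    have "{S \<in> \<S>. induced_iso E S E' T} = {S \<in> copies E V E' T. nbhd E V S = {}}"
      using that by (auto simp: \<S>_def copies_def)
    moreover have "{S \<in> \<T>. induced_iso E' S E' T} = {S \<in> copies E' V' E' T. nbhd E' V' S = {}}"
      using copy_cases[OF T] closed_copy_avoids_cycle[OF T] by (auto simp: \<T>_def copies_def)
    ultimately show ?thesis using card_closed_copies[OF T] by simp
  qed
  have cover: "\<exists>T\<in>\<T>. induced_iso E S E' T" if "S \<in> \<S>" for S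
    using that by (auto simp: \<S>_def)
  have cards: "(\<Sum>S\<in>\<S>. card S) = (\<Sum>T\<in>\<T>. card T)"
    by (rule sum_iso_classes[OF fin(2,1) cover count]) (simp_all add: induced_iso_card)
  have adjs: "(\<Sum>S\<in>\<S>. adj_card E S S) = (\<Sum>T\<in>\<T>. adj_card E' T T)"
    by (rule sum_iso_classes[OF fin(2,1) cover count]) (simp_all add: induced_iso_adj_card)
  have "S \<subseteq> V \<and> connected_in E S \<and> nbhd E V S = {}" if "S \<in> \<S>" for S
    using that induced_iso_connected_in[OF induced_iso_sym] by (auto simp: \<S>_def \<T>_def)
  note sumF = F.closed_family_sums[OF finV fin(2) this]
  have "T \<subseteq> V' \<and> connected_in E' T \<and> nbhd E' V' T = {}" if "T \<in> \<T>" for T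
    using that by (auto simp: \<T>_def)
  note sumH = H.closed_family_sums[OF H.fin fin(1) this]
  have eq: "adj_card E R R = adj_card E' B B" "card R = card B"
    using sumF sumH cards adjs adj_card_eq card_eq by (simp_all add: R_def B_def)
  have fB: "finite B" using H.fin by (simp add: B_def)
  have CB: "C \<subseteq> B" using H.C_subset by (auto simp: B_def \<T>_def)
  \<comment> \<open>To see that \<open>B\<close> has at least as many edges as vertices, absorb
    vertices into \<open>C\<close> one at a time: each new one brings an edge. A maximal such
    \<open>A\<close> has no edges to \<open>B - A\<close>.\<close>
  define P where "P A \<longleftrightarrow> C \<subseteq> A \<and> A \<subseteq> B \<and> 2 * card A \<le> adj_card E' A A" for A
  have "P C" using CB H.C_dense by (simp add: P_def)
  moreover have "\<forall>A. P A \<longrightarrow> card A < Suc (card B)"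
    using fB by (auto simp: P_def less_Suc_eq_le intro: card_mono)
  ultimately have "\<exists>A. P A \<and> (\<forall>A'. P A' \<longrightarrow> card A' \<le> card A)"
    by (rule ex_has_greatest_nat)
  then obtain A where A: "P A" and max: "\<And>A'. P A' \<Longrightarrow> card A' \<le> card A" by blast
  have fA: "finite A" using A fB finite_subset by (auto simp: P_def)
  have no_edge: "\<not> E' a b" if "a \<in> A" "b \<in> B - A" for a b
  proof
    assume "E' a b"
    then have "adj_card E' {b} A \<ge> 1"
      using adj_card_ge_1[of "{b}" A b a E'] fA that H.adj_sym by auto
    then have "P (insert b A)"
      using A that H.adj_card_insert[of A b] fA by (auto simp: P_def)
    from max[OF this] show False using that fA by simp
  qed
  have "A = B"
  proof (rule ccontr)
    assume "A \<noteq> B"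
    then have ne: "B - A \<noteq> {}" using A by (auto simp: P_def)
    have sub: "B - A \<subseteq> V'" by (auto simp: B_def)
    \<comment> \<open>So a nonempty \<open>B - A\<close> is a union of components avoiding
      \<open>C\<close>, but all of these have been deleted.\<close>
    have "nbhd E' V' (B - A) = {}"
      unfolding nbhd_eq_empty_iff
    proof (intro ballI notI)
      fix s v assume s: "s \<in> B - A" and v: "v \<in> V' - (B - A)" and "E' s v"
      then have vs: "E' v s" using H.adj_sym by blast
      then have "v \<notin> A" using no_edge s by blast
      then obtain T where "T \<in> \<T>" "v \<in> T" using v by (auto simp: B_def)
      then show False using vs s by (auto simp: \<T>_def B_def nbhd_eq_empty_iff)
    qed
    from H.closed_contains_connected_closed[OF _ ne sub this] fB
    obtain T where T: "T \<subseteq> B - A" "connected_in E' T" "nbhd E' V' T = {}" by auto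
    then have "T \<in> \<T>" using A sub by (auto simp: \<T>_def P_def)
    then have "T \<inter> B = {}" by (auto simp: B_def)
    then show False using T by (auto simp: connected_in_def)
  qed
  then have dense: "2 * card B \<le> adj_card E' B B" using A by (simp add: P_def)
  have "card B > 0" using CB H.C_nonempty fB by (auto simp: card_gt_0_iff)
  then have "R \<noteq> {}" using eq by auto
  moreover have "R \<subseteq> V" by (auto simp: R_def)
  ultimately show False using forest[of R] dense eq by simp
qed

end

section \<open>Cycles in the sense of arc walks\<close>

lemma graph_simple_adj:
  assumes "graph G"
  shows "simple_adj (dominates G)"
proof -
  interpret graph G by fact
  show ?thesis
    using adj_not_same arcs_ends_symmetric[OF sym_arcs] by unfold_locales auto
qed

lemma (in simple_adj) exists_shortest_cycle:
  assumes "finite V" "W \<subseteq> V" "W \<noteq> {}" "2 * card W \<le> adj_card E W W"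
  shows "\<exists>C. shortest_cycle E V C"
proof -
  define P where "P C \<longleftrightarrow> C \<subseteq> V \<and> C \<noteq> {} \<and> 2 * card C \<le> adj_card E C C" for C
  have "P W" using assms by (simp add: P_def)
  then obtain C where C: "P C" and min: "\<And>C'. P C' \<Longrightarrow> card C \<le> card C'"
    using ex_has_least_nat[of P W card] by blast
  have "shortest_cycle E V C"
  proof
    show "adj_card E X X < 2 * card X" if "X \<subseteq> V" "X \<noteq> {}" "card X < card C" for X
    proof (rule ccontr)
      assume "\<not> ?thesis"
      then have "P X" using that by (simp add: P_def)
      from min[OF this] show False using that by simp
    qed
  qed (use C assms(1) in \<open>simp_all add: P_def\<close>)
  then show ?thesis by blast
qed

text \<open>On a closed walk of length at least 3 without repeated vertices, each vertex has two
  distinct neighbours.\<close>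

lemma has_cycle_imp_dense:
  assumes "graph G" "has_cycle G"
  shows "\<exists>W\<subseteq>verts G. W \<noteq> {} \<and> 2 * card W \<le> adj_card (dominates G) W W"
proof -
  interpret graph G by fact
  interpret simple_adj "dominates G" by (rule graph_simple_adj) fact
  obtain p u where p: "awalk u p u" "distinct (tl (awalk_verts u p))" "3 \<le> length p"
    using assms(2) by (auto simp: has_cycle_def cycle_def)
  define m where "m = length p"
  have arcs: "set p \<subseteq> arcs G" and cas: "cas u p u" using p(1) by (auto simp: awalk_def)
  have ne: "p \<noteq> []" using p(3) by auto
  have verts: "map (tail G) p @ [head G (last p)] = tail G (hd p) # map (head G) p"
    using awalk_verts_conv[of u p] awalk_verts_conv'[OF cas] ne by simp
  have hd_last: "tail G (hd p) = head G (last p)"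
    using awlast_if_cas[OF cas] awhd_if_cas[OF cas] awalk_verts_conv[of u p] ne
    by (simp add: hd_append hd_map)
  have dist: "distinct (map (head G) p)"
    using p(2) awalk_verts_conv'[OF cas] ne by simp
  have pred: "tail G (p ! i) = head G (p ! (if i = 0 then m - 1 else i - 1))" if "i < m" for i
  proof (cases i)
    case 0
    then show ?thesis using hd_last ne by (simp add: hd_conv_nth last_conv_nth m_def)
  next
    case (Suc j)
    have "(map (tail G) p @ [head G (last p)]) ! Suc j = (tail G (hd p) # map (head G) p) ! Suc j"
      using verts by simp
    then show ?thesis using Suc that by (simp add: nth_append m_def)
  qed
  define W where "W = set (map (head G) p)"
  have cW: "card W = m" using distinct_card[OF dist] by (simp add: W_def m_def)
  have dom: "dominates G (tail G (p ! i)) (head G (p ! i))" if "i < m" for i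
    using that arcs by (force simp: arcs_ends_conv m_def)
  have "2 \<le> adj_card (dominates G) {w} W" if w: "w \<in> W" for w
  proof -
    obtain i where i: "i < m" "w = head G (p ! i)"
      using w by (auto simp: W_def in_set_conv_nth m_def)
    \<comment> \<open>Cyclic predecessor and successor of \<open>i\<close>; they differ because
      \<open>m \<ge> 3\<close>.\<close>
    let ?i = "if i = 0 then m - 1 else i - 1" and ?j = "if i = m - 1 then 0 else i + 1"
    have m3: "3 \<le> m" using p(3) by (simp add: m_def)
    have lt: "?i < m" "?j < m" and neq: "?i \<noteq> ?j" using i m3 by auto
    have "tail G (p ! ?j) = head G (p ! i)" using pred[OF lt(2)] i by auto
    then have "dominates G w (head G (p ! ?j))" using dom[OF lt(2)] i by simp
    moreover have "dominates G w (head G (p ! ?i))"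
      using dom[OF i(1)] pred[OF i(1)] i(2) adj_sym by simp
    ultimately have "{head G (p ! ?i), head G (p ! ?j)} \<subseteq> {b \<in> W. dominates G w b}"
      using lt by (auto simp: W_def m_def)
    then have "card {head G (p ! ?i), head G (p ! ?j)} \<le> adj_card (dominates G) {w} W"
      unfolding adj_card_singleton by (intro card_mono) (simp_all add: W_def)
    moreover have "head G (p ! ?i) \<noteq> head G (p ! ?j)"
      using nth_eq_iff_index_eq[OF dist, of ?i ?j] lt neq by (simp add: m_def del: if_split)
    ultimately show ?thesis by simp
  qed
  then have "(\<Sum>w\<in>W. 2) \<le> adj_card (dominates G) W W"
    using adj_card_sum[of W W "dominates G"] by (simp add: W_def sum_mono del: sum_constant)
  then have "2 * card W \<le> adj_card (dominates G) W W" by simp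
  moreover have "W \<subseteq> verts G" using arcs head_in_verts by (auto simp: W_def)
  moreover have "W \<noteq> {}" using ne by (simp add: W_def)
  ultimately show ?thesis by blast
qed

lemma (in wf_digraph) awalk_of_successively:
  assumes "xs \<noteq> []" "set xs \<subseteq> verts G" "successively (dominates G) xs"
  shows "\<exists>p. awalk (hd xs) p (last xs) \<and> awalk_verts (hd xs) p = xs"
  using assms
proof (induction xs rule: induct_list012)
  case (2 x)
  then show ?case by (intro exI[of _ "[]"]) (simp add: awalk_Nil_iff)
next
  case (3 x y zs)
  obtain p where p: "awalk y p (last (y # zs))" "awalk_verts y p = y # zs"
    using 3 by auto
  obtain e where "e \<in> arcs G" "tail G e = x" "head G e = y" using 3 by auto
  then show ?case
    using p by (intro exI[of _ "e # p"]) (auto simp: awalk_Cons_iff)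
qed simp

text \<open>Take a longest path inside a shortest cycle \<open>C\<close>. Both neighbours of its
  first vertex \<open>x\<close> in \<open>C\<close> lie on the path, and the one that does not
  follow \<open>x\<close> directly closes a cycle.\<close>

lemma dense_imp_has_cycle:
  assumes "graph G" "W \<subseteq> verts G" "W \<noteq> {}" "2 * card W \<le> adj_card (dominates G) W W"
  shows "has_cycle G"
proof -
  interpret graph G by fact
  interpret S: simple_adj "dominates G" by (rule graph_simple_adj) fact
  obtain C where "shortest_cycle (dominates G) (verts G) C"
    using S.exists_shortest_cycle[OF finite_verts assms(2-4)] by blast
  then interpret C: shortest_cycle "dominates G" "verts G" C .
  define P where "P xs \<longleftrightarrow> xs \<noteq> [] \<and> distinct xs \<and> set xs \<subseteq> C \<and> successively (dominates G) xs" for xs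
  obtain c where "c \<in> C" using C.C_nonempty by auto
  then have "P [c]" by (simp add: P_def)
  moreover have "\<forall>xs. P xs \<longrightarrow> length xs < Suc (card C)"
  proof (intro allI impI)
    fix xs assume xs: "P xs"
    then have "length xs = card (set xs)" by (simp add: P_def distinct_card)
    also have "\<dots> \<le> card C" using xs C.finite_C by (intro card_mono) (simp_all add: P_def)
    finally show "length xs < Suc (card C)" by simp
  qed
  ultimately have "\<exists>xs. P xs \<and> (\<forall>ys. P ys \<longrightarrow> length ys \<le> length xs)"
    by (rule ex_has_greatest_nat)
  then obtain xs where xs: "P xs" and max: "\<And>ys. P ys \<Longrightarrow> length ys \<le> length xs" by blast
  obtain x rest where x: "xs = x # rest" using xs by (cases xs) (auto simp: P_def)
  have xC: "x \<in> C" using xs x by (simp add: P_def)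
  have nb: "z \<in> set rest" if "z \<in> C" "dominates G x z" for z
  proof (rule ccontr)
    assume "z \<notin> set rest"
    moreover have "z \<noteq> x" using that S.adj_irrefl by auto
    moreover have "dominates G z x" using that S.adj_sym by blast
    ultimately have "P (z # xs)" using xs that by (auto simp: P_def x successively_Cons)
    from max[OF this] show False by simp
  qed
  have two: "card {z \<in> C. dominates G x z} = 2"
    using C.deg_eq_2[OF xC] by (simp add: adj_card_singleton)
  \<comment> \<open>Avoiding \<open>hd rest\<close> rules out the walk from \<open>x\<close> to
    \<open>z\<close> and straight back. The count is also valid for empty \<open>rest\<close>, where
    \<open>hd rest\<close> is some unspecified vertex.\<close>
  have "\<not> {z \<in> C. dominates G x z} \<subseteq> {hd rest}"
  proof
    assume "{z \<in> C. dominates G x z} \<subseteq> {hd rest}"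
    then have "card {z \<in> C. dominates G x z} \<le> card {hd rest}" by (rule card_mono[rotated]) simp
    then show False using two by simp
  qed
  then obtain z where z: "z \<in> C" "dominates G x z" "z \<noteq> hd rest" by blast
  obtain as bs where rest: "rest = as @ z # bs"
    using split_list[OF nb[OF z(1,2)]] by blast
  have as: "as \<noteq> []" using z(3) rest by auto
  let ?ys = "(x # as @ [z]) @ [x]"
  have succ: "successively (dominates G) ((x # as @ [z]) @ bs)"
    using xs x rest by (simp add: P_def)
  then have "successively (dominates G) (x # as @ [z])"
    unfolding successively_append_iff by blast
  then have "successively (dominates G) ?ys"
    unfolding successively_append_iff[of _ "x # as @ [z]" "[x]"] using S.adj_sym[OF z(2)] by simp
  moreover have "set ?ys \<subseteq> verts G"
    using xs x rest C.C_subset by (auto simp: P_def)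
  ultimately obtain p where p: "awalk x p x" "awalk_verts x p = ?ys"
    using awalk_of_successively[of ?ys] by auto
  have "length p = Suc (Suc (length as))"
    using length_awalk_verts[of x p] p(2) by simp
  moreover have "length as > 0" using as by simp
  ultimately have "3 \<le> length p" by linarith
  moreover have "distinct (tl (awalk_verts x p))"
    using xs x rest p(2) by (auto simp: P_def)
  ultimately show ?thesis
    using p(1) unfolding has_cycle_def cycle_def by fastforce
qed

lemma has_cycle_transfer:
  assumes "graph G" "graph G'" "card (verts G) = n" "card (verts G') = n"
    and "n + 1 \<le> 2 * k" "k \<le> n" "(n, k) \<noteq> (5, 3)" "deck k G = deck k G'" "has_cycle G'"
  shows "has_cycle G"
proof (rule ccontr)
  assume acyclic: "\<not> has_cycle G"
  interpret G: graph G by fact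
  interpret G': graph G' by fact
  interpret F: simple_adj "dominates G" by (rule graph_simple_adj) fact
  interpret H: simple_adj "dominates G'" by (rule graph_simple_adj) fact
  obtain W where "W \<subseteq> verts G'" "W \<noteq> {}" "2 * card W \<le> adj_card (dominates G') W W"
    using has_cycle_imp_dense[OF assms(2,9)] by blast
  then obtain C where "shortest_cycle (dominates G') (verts G') C"
    using H.exists_shortest_cycle[OF G'.finite_verts] by blast
  then interpret C: shortest_cycle "dominates G'" "verts G'" C .
  interpret same_moments "dominates G" "dominates G'" "verts G'" C "verts G" k
  proof
    show "(\<Sum>S\<in>copies (dominates G) (verts G) (dominates G') T. card (nbhd (dominates G) (verts G) S) choose i) =
        (\<Sum>S\<in>copies (dominates G') (verts G') (dominates G') T. card (nbhd (dominates G') (verts G') S) choose i)"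
      if "card T + i \<le> k" for T i
      by (rule deck_moments[OF G.fin_digraph_axioms G'.fin_digraph_axioms _ _ assms(8) that])
        (simp_all add: assms)
    show "adj_card (dominates G) W W < 2 * card W" if "W \<subseteq> verts G" "W \<noteq> {}" for W
      using dense_imp_has_cycle[OF assms(1) that] acyclic by (meson not_le)
  qed (use assms in simp_all)
  show False by (rule contradiction)
qed

theorem theorem1p2:
  fixes G :: "('a, 'b) pre_digraph" and G' :: "('c, 'd) pre_digraph"
    and n l :: nat
  assumes "l \<ge> 1" and "n \<ge> 2 * l + 1" and "(n, l) \<noteq> (5, 2)"
    and "graph G" and "graph G'"
    and "card (verts G) = n" and "card (verts G') = n"
    and "deck (n - l) G = deck (n - l) G'"
  shows "has_cycle G \<longleftrightarrow> has_cycle G'"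
proof -
  \<comment> \<open>In terms of \<open>k = n - l\<close>, the bound \<open>n \<ge> 2 * l + 1\<close>
    reads \<open>n + 1 \<le> 2 * k\<close>, and the exception \<open>(5, 2)\<close> becomes
    \<open>(5, 3)\<close>.\<close>
  have k: "n + 1 \<le> 2 * (n - l)" "n - l \<le> n" "(n, n - l) \<noteq> (5, 3)"
    using assms(1-3) by auto
  show ?thesis
    using has_cycle_transfer[OF assms(4-7) k assms(8)]
      has_cycle_transfer[OF assms(5,4,7,6) k assms(8)[symmetric]]
    by blast
qed

end
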